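(* Let $\mathcal{M}$ be a 3-dimensional manifold with local coordinates $x=(x^1,x^2,x^3)$ and consider the driftless $x$-flat system $$\dot x = g_1(x)u^1+g_2(x)u^2,\qquad x(0)=x_0,$$ with smooth vector fields $g_1,g_2$ and $x$-flat output $\varphi=(\varphi^1,\varphi^2)$, where $L_{g_2}\varphi^i=0$ for $i=1,2$. Let $\mathcal{I}=[0,T]$, $y_d\in C^\infty(\mathcal{I},\mathbb{R}^2)$, $e^i=y_d^i-\varphi^i(x)$, $\dot e^i=\dot y_d^i-L_{g_1}\varphi^i\,u^1$. Let $\bar Q,Q,M$ be constant symmetric positive definite $2\times2$ matrices with $[M^{lm}]=M^{-1}$ and $Q_{ij}=\bar Q_{il}M^{lm}\bar Q_{mj}$. Consider the fixed-time, free-endpoint optimal control problem of minimizing $$J(u)=\tfrac12 e^i\bar Q_{ij}e^j\Big|_{t=T}+\int_0^T\tfrac12\big(e^iQ_{ij}e^j+\dot e^iM_{ij}\dot e^j\big)\,dt$$ subject to the system dynamics and $|u^a|\le u^a_{\max}$, $a=1,2$. Then on the singular arc the tracking error satisfies the linear, two-dimensional dynamics $$\dot e^j=A^j_i\,e^i,\qquad A^j_i=-\bar Q_{il}M^{lj},\qquad j=1,2 .$$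
   Context: The Einstein summation convention is used; $L_g\varphi=g^k\partial_{x^k}\varphi$ is the Lie derivative and $[g_1,g_2]^k=g_1^l\partial_{x^l}g_2^k-g_2^l\partial_{x^l}g_1^k$ is the Lie bracket. Flatness. A system $\dot x=f(x,u)$ with $m$ inputs is $x$-flat if there is an $m$-tuple $y=\varphi(x)$ (the $x$-flat output) such that $(x,u)=F(y,\dot y,\dots,y^{(r)})$ for some smooth $F$. All considerations are local. For the system considered here, $x$-flatness is equivalent to local equivalence, by a state transformation and a static input transformation, to the chained form $\dot z^1=v^1,\ \dot z^2=z^3v^1,\ \dot z^3=v^2$ with flat output $(z^1,z^2)$. After a static input transformation it is assumed that $L_{g_2}\varphi^i=0$, $i=1,2$. Flatness then gives that $g_1,g_2,[g_1,g_2]$ span the tangent space and that $$\det\begin{bmatrix}L_{g_1}\varphi^1&L_{[g_1,g_2]}\varphi^1\\ L_{g_1}\varphi^2&L_{[g_1,g_2]}\varphi^2\end{bmatrix}\neq0 .$$ Necessary conditions. The Hamiltonian is $H=\tfrac12(e^iQ_{ij}e^j+\dot e^iM_{ij}\dot e^j)+\lambda_lg_a^lu^a$. The costate satisfies $$\dot\lambda_k=e^iQ_{ij}\partial_{x^k}\varphi^j+\dot e^iM_{ij}\,\partial_{x^k}(L_{g_1}\varphi^j)\,u^1-\lambda_l\,\partial_{x^k}g_a^l\,u^a,\qquad \lambda_k\big|_{t=T}=-e^i\bar Q_{ij}\partial_{x^k}\varphi^j\big|_{t=T}.$$ Put $\xi_1=\partial_{u^1}H=-\dot e^iM_{ij}L_{g_1}\varphi^j+\lambda_lg_1^l$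 and $\xi_2=\partial_{u^2}H=\lambda_lg_2^l$. The input $u^1$ is regular (it is determined by $\xi_1=0$, with $\partial^2_{u^1u^1}H>0$), while $H$ is affine in $u^2$, so $u^2$ is singular. Singular arc. A singular arc is a nontrivial time interval $\mathcal{I}_s\subseteq\mathcal{I}$ on which $\xi_1=0$, $\xi_2\equiv0$ and the successive time derivatives of $\xi_2$ vanish; in particular $\dot\xi_2=\big[-\dot e^iM_{ij}L_{[g_1,g_2]}\varphi^j+\lambda_l[g_1,g_2]^l\big]u^1=0$, which is understood as the vanishing of the bracket (i.e. $u^1\neq0$).
   Formalization: The singular arc is additionally required to reach the final time T (T lies in the closure of the arc), where the terminal condition on the costate applies; for a singular arc that ends before T the stated error dynamics can fail even for an optimal trajectory. *)

theory Defs
  imports "HOL-Analysis.Analysis" "HOL-Library.Countable_Set"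
begin

(* Used for open sets S only, where "f is C^(k+1)" means: f is differentiable and all its
   partial derivatives are C^k. *)
fun Ck_on :: "nat \<Rightarrow> ('a::euclidean_space \<Rightarrow> 'b::real_normed_vector) \<Rightarrow> 'a set \<Rightarrow> bool" where
  "Ck_on 0 f S \<longleftrightarrow> continuous_on S f"
| "Ck_on (Suc k) f S \<longleftrightarrow>
     f differentiable_on S \<and> (\<forall>b\<in>Basis. Ck_on k (\<lambda>x. frechet_derivative f (at x) b) S)"

definition smooth_on :: "'a::euclidean_space set \<Rightarrow> ('a \<Rightarrow> 'b::real_normed_vector) \<Rightarrow> bool" where
  "smooth_on S f \<longleftrightarrow> (\<forall>k. Ck_on k f S)"

(* C^infinity on a closed interval, with one-sided derivatives at its end points. *)
definition smooth_on_interval :: "real \<Rightarrow> real \<Rightarrow> (real \<Rightarrow> 'b::real_normed_vector) \<Rightarrow> bool" where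
  "smooth_on_interval a b y \<longleftrightarrow>
     (\<exists>D :: nat \<Rightarrow> real \<Rightarrow> 'b. (\<forall>t\<in>{a..b}. D 0 t = y t) \<and>
       (\<forall>k. \<forall>t\<in>{a..b}. (D k has_vector_derivative D (Suc k) t) (at t within {a..b})))"

definition spd :: "real^'n^'n \<Rightarrow> bool" where
  "spd A \<longleftrightarrow> transpose A = A \<and> (\<forall>v. v \<noteq> 0 \<longrightarrow> 0 < v \<bullet> (A *v v))"


section \<open>Vector fields in local coordinates\<close>

definition partial :: "'n \<Rightarrow> (real^'n \<Rightarrow> real) \<Rightarrow> real^'n \<Rightarrow> real" where
  "partial k h x = frechet_derivative h (at x) (axis k 1)"

definition partial_vec :: "'n \<Rightarrow> (real^'n \<Rightarrow> real^'m) \<Rightarrow> real^'n \<Rightarrow> real^'m" where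
  "partial_vec k f x = (\<chi> i. partial k (\<lambda>y. f y $ i) x)"

definition lie_deriv :: "(real^'n \<Rightarrow> real^'n) \<Rightarrow> (real^'n \<Rightarrow> real) \<Rightarrow> real^'n \<Rightarrow> real" where
  "lie_deriv g h x = (\<Sum>k\<in>UNIV. g x $ k * partial k h x)"

definition lie_deriv_vec :: "(real^'n \<Rightarrow> real^'n) \<Rightarrow> (real^'n \<Rightarrow> real^'m) \<Rightarrow> real^'n \<Rightarrow> real^'m" where
  "lie_deriv_vec g f x = (\<chi> i. lie_deriv g (\<lambda>y. f y $ i) x)"

definition lie_bracket ::
    "(real^'n \<Rightarrow> real^'n) \<Rightarrow> (real^'n \<Rightarrow> real^'n) \<Rightarrow> real^'n \<Rightarrow> real^'n" where
  "lie_bracket g1 g2 x =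
     (\<chi> k. \<Sum>l\<in>UNIV. g1 x $ l * partial l (\<lambda>y. g2 y $ k) x - g2 x $ l * partial l (\<lambda>y. g1 y $ k) x)"

definition driftless ::
    "(real^3 \<Rightarrow> real^3) \<Rightarrow> (real^3 \<Rightarrow> real^3) \<Rightarrow> real^3 \<Rightarrow> real^2 \<Rightarrow> real^3" where
  "driftless g1 g2 x u = u $ 1 *\<^sub>R g1 x + u $ 2 *\<^sub>R g2 x"


section \<open>Flatness\<close>

definition smooth_solution ::
    "(real^3) set \<Rightarrow> (real^3 \<Rightarrow> real^3) \<Rightarrow> (real^3 \<Rightarrow> real^3) \<Rightarrow>
     real set \<Rightarrow> (real \<Rightarrow> real^3) \<Rightarrow> (real \<Rightarrow> real^2) \<Rightarrow> bool" where
  "smooth_solution U g1 g2 J x u \<longleftrightarrow>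
     smooth_on J x \<and> smooth_on J u \<and>
     (\<forall>t\<in>J. x t \<in> U \<and> (x has_vector_derivative driftless g1 g2 (x t) (u t)) (at t))"

(* The r-jet (y, y', ..., y^(r)) with r + 1 = CARD('r); the component k of the finite index
   type is the derivative of order to_nat_on UNIV k, and to_nat_on UNIV is a bijection from
   UNIV :: 'r set onto {..r}. *)
definition jet :: "(real \<Rightarrow> real^2) \<Rightarrow> real \<Rightarrow> real^2^'r" where
  "jet y t = (\<chi> k. ((\<lambda>f s. vector_derivative f (at s)) ^^ to_nat_on (UNIV :: 'r set) k) y t)"

(* (x,u) = F(y, y', ..., y^(r)) locally around the state x0: F is a smooth map on an open set W
   of jets that attains a point (x0,u0); solutions near (x0,u0) whose output jet lies in W are
   recovered by F from the output y = phi(x), and conversely the curves y are free: F maps each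
   of them (with jets in W) to a solution whose output is y.  The order r of F is arbitrary: it
   is carried by the type variable 'r, so that in the hypothesis of a theorem "for every 'r"
   stands for "if there is an r". For the chained form, for example, W excludes y1' = 0, so
   that W cannot be taken to contain all jets. *)
definition x_flat_output_at ::
    "'r::finite itself \<Rightarrow> (real^3) set \<Rightarrow> (real^3 \<Rightarrow> real^3) \<Rightarrow> (real^3 \<Rightarrow> real^3) \<Rightarrow>
     (real^3 \<Rightarrow> real^2) \<Rightarrow> real^3 \<Rightarrow> bool" where
  "x_flat_output_at R U g1 g2 phi x0 \<longleftrightarrow>
     (\<exists>(F :: real^2^'r \<Rightarrow> (real^3) \<times> (real^2)) W N u0.
        open W \<and> smooth_on W F \<and> (x0, u0) \<in> F ` W \<and> open N \<and> (x0, u0) \<in> N \<and>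
        (\<forall>a b x u. smooth_solution U g1 g2 {a<..<b} x u \<longrightarrow>
           (\<forall>t\<in>{a<..<b}. (x t, u t) \<in> N \<longrightarrow> jet (\<lambda>s. phi (x s)) t \<in> W \<longrightarrow>
              (x t, u t) = F (jet (\<lambda>s. phi (x s)) t))) \<and>
        (\<forall>a b y. smooth_on {a<..<b} y \<longrightarrow> (\<forall>t\<in>{a<..<b}. jet y t \<in> W) \<longrightarrow>
           smooth_solution U g1 g2 {a<..<b} (\<lambda>t. fst (F (jet y t))) (\<lambda>t. snd (F (jet y t))) \<and>
           (\<forall>t\<in>{a<..<b}. phi (fst (F (jet y t))) = y t)))"

definition x_flat_output ::
    "'r::finite itself \<Rightarrow> (real^3) set \<Rightarrow> (real^3 \<Rightarrow> real^3) \<Rightarrow> (real^3 \<Rightarrow> real^3) \<Rightarrow>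
     (real^3 \<Rightarrow> real^2) \<Rightarrow> bool" where
  "x_flat_output R U g1 g2 phi \<longleftrightarrow>
     smooth_on U phi \<and> (\<forall>x0\<in>U. x_flat_output_at R U g1 g2 phi x0)"


section \<open>The optimal control problem\<close>

definition err :: "(real \<Rightarrow> real^2) \<Rightarrow> (real^3 \<Rightarrow> real^2) \<Rightarrow> (real \<Rightarrow> real^3) \<Rightarrow> real \<Rightarrow> real^2" where
  "err yd phi x t = yd t - phi (x t)"

definition err_dot ::
    "real \<Rightarrow> (real \<Rightarrow> real^2) \<Rightarrow> (real^3 \<Rightarrow> real^3) \<Rightarrow> (real^3 \<Rightarrow> real^2) \<Rightarrow>
     (real \<Rightarrow> real^3) \<Rightarrow> (real \<Rightarrow> real^2) \<Rightarrow> real \<Rightarrow> real^2" where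
  "err_dot T yd g1 phi x u t =
     vector_derivative yd (at t within {0..T}) - u t $ 1 *\<^sub>R lie_deriv_vec g1 phi (x t)"

definition cost ::
    "real \<Rightarrow> (real \<Rightarrow> real^2) \<Rightarrow> (real^3 \<Rightarrow> real^3) \<Rightarrow> (real^3 \<Rightarrow> real^2) \<Rightarrow>
     real^2^2 \<Rightarrow> real^2^2 \<Rightarrow> real^2^2 \<Rightarrow> (real \<Rightarrow> real^3) \<Rightarrow> (real \<Rightarrow> real^2) \<Rightarrow> real" where
  "cost T yd g1 phi Qbar Q M x u =
     1/2 * (err yd phi x T \<bullet> (Qbar *v err yd phi x T)) +
     integral {0..T} (\<lambda>t. 1/2 * (err yd phi x t \<bullet> (Q *v err yd phi x t) +
       err_dot T yd g1 phi x u t \<bullet> (M *v err_dot T yd g1 phi x u t)))"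

(* The bounded controls are continuous up to finitely many times; the state is continuous and
   satisfies the differential equation at the other times. *)
definition admissible ::
    "(real^3) set \<Rightarrow> (real^3 \<Rightarrow> real^3) \<Rightarrow> (real^3 \<Rightarrow> real^3) \<Rightarrow> real^3 \<Rightarrow> real^2 \<Rightarrow> real \<Rightarrow>
     (real \<Rightarrow> real^3) \<Rightarrow> (real \<Rightarrow> real^2) \<Rightarrow> bool" where
  "admissible U g1 g2 x0 umax T x u \<longleftrightarrow>
     x 0 = x0 \<and> continuous_on {0..T} x \<and> (\<forall>t\<in>{0..T}. x t \<in> U) \<and>
     (\<forall>t\<in>{0..T}. \<forall>a. \<bar>u t $ a\<bar> \<le> umax $ a) \<and>
     (\<exists>S. finite S \<and> continuous_on ({0..T} - S) u \<and>
       (\<forall>t\<in>{0..T} - S.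
          (x has_vector_derivative driftless g1 g2 (x t) (u t)) (at t within {0..T})))"

definition optimal ::
    "(real^3) set \<Rightarrow> (real^3 \<Rightarrow> real^3) \<Rightarrow> (real^3 \<Rightarrow> real^3) \<Rightarrow> (real^3 \<Rightarrow> real^2) \<Rightarrow>
     real^3 \<Rightarrow> real^2 \<Rightarrow> real \<Rightarrow> (real \<Rightarrow> real^2) \<Rightarrow> real^2^2 \<Rightarrow> real^2^2 \<Rightarrow> real^2^2 \<Rightarrow>
     (real \<Rightarrow> real^3) \<Rightarrow> (real \<Rightarrow> real^2) \<Rightarrow> bool" where
  "optimal U g1 g2 phi x0 umax T yd Qbar Q M x u \<longleftrightarrow>
     admissible U g1 g2 x0 umax T x u \<and>
     (\<forall>x' u'. admissible U g1 g2 x0 umax T x' u' \<longrightarrow>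
        cost T yd g1 phi Qbar Q M x u \<le> cost T yd g1 phi Qbar Q M x' u')"

(* The right-hand side is minus the derivative with respect to x^k of the Hamiltonian
   1/2 (e Q e + e' M e') + lam . (g1 u1 + g2 u2). *)
definition costate_rhs ::
    "real \<Rightarrow> (real \<Rightarrow> real^2) \<Rightarrow> (real^3 \<Rightarrow> real^3) \<Rightarrow> (real^3 \<Rightarrow> real^3) \<Rightarrow> (real^3 \<Rightarrow> real^2) \<Rightarrow>
     real^2^2 \<Rightarrow> real^2^2 \<Rightarrow> (real \<Rightarrow> real^3) \<Rightarrow> (real \<Rightarrow> real^2) \<Rightarrow> (real \<Rightarrow> real^3) \<Rightarrow> real \<Rightarrow> real^3"
  where
  "costate_rhs T yd g1 g2 phi Q M x u lam t =
     (\<chi> k. err yd phi x t \<bullet> (Q *v partial_vec k phi (x t)) +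
           err_dot T yd g1 phi x u t \<bullet> (M *v partial_vec k (lie_deriv_vec g1 phi) (x t)) * u t $ 1 -
           (lam t \<bullet> partial_vec k g1 (x t) * u t $ 1 + lam t \<bullet> partial_vec k g2 (x t) * u t $ 2))"

(* A linear terminal value problem for lam: the costate exists and is unique for every
   admissible pair (x,u). *)
definition costate ::
    "real \<Rightarrow> (real \<Rightarrow> real^2) \<Rightarrow> (real^3 \<Rightarrow> real^3) \<Rightarrow> (real^3 \<Rightarrow> real^3) \<Rightarrow> (real^3 \<Rightarrow> real^2) \<Rightarrow>
     real^2^2 \<Rightarrow> real^2^2 \<Rightarrow> real^2^2 \<Rightarrow> (real \<Rightarrow> real^3) \<Rightarrow> (real \<Rightarrow> real^2) \<Rightarrow> (real \<Rightarrow> real^3) \<Rightarrow> bool"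
  where
  "costate T yd g1 g2 phi Qbar Q M x u lam \<longleftrightarrow>
     continuous_on {0..T} lam \<and>
     (\<exists>S. finite S \<and> (\<forall>t\<in>{0..T} - S.
        (lam has_vector_derivative costate_rhs T yd g1 g2 phi Q M x u lam t) (at t within {0..T}))) \<and>
     lam T = (\<chi> k. - (err yd phi x T \<bullet> (Qbar *v partial_vec k phi (x T))))"

(* Both are partial derivatives of the Hamiltonian: with respect to u1 and u2. *)
definition xi1 ::
    "real \<Rightarrow> (real \<Rightarrow> real^2) \<Rightarrow> (real^3 \<Rightarrow> real^3) \<Rightarrow> (real^3 \<Rightarrow> real^2) \<Rightarrow> real^2^2 \<Rightarrow>
     (real \<Rightarrow> real^3) \<Rightarrow> (real \<Rightarrow> real^2) \<Rightarrow> (real \<Rightarrow> real^3) \<Rightarrow> real \<Rightarrow> real" where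
  "xi1 T yd g1 phi M x u lam t =
     - (err_dot T yd g1 phi x u t \<bullet> (M *v lie_deriv_vec g1 phi (x t))) + lam t \<bullet> g1 (x t)"

definition xi2 :: "(real^3 \<Rightarrow> real^3) \<Rightarrow> (real \<Rightarrow> real^3) \<Rightarrow> (real \<Rightarrow> real^3) \<Rightarrow> real \<Rightarrow> real" where
  "xi2 g2 x lam t = lam t \<bullet> g2 (x t)"

(* The time derivative of xi2 is u1 times this quantity. *)
definition xi2_dot_bracket ::
    "real \<Rightarrow> (real \<Rightarrow> real^2) \<Rightarrow> (real^3 \<Rightarrow> real^3) \<Rightarrow> (real^3 \<Rightarrow> real^3) \<Rightarrow> (real^3 \<Rightarrow> real^2) \<Rightarrow>
     real^2^2 \<Rightarrow> (real \<Rightarrow> real^3) \<Rightarrow> (real \<Rightarrow> real^2) \<Rightarrow> (real \<Rightarrow> real^3) \<Rightarrow> real \<Rightarrow> real" where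
  "xi2_dot_bracket T yd g1 g2 phi M x u lam t =
     - (err_dot T yd g1 phi x u t \<bullet> (M *v lie_deriv_vec (lie_bracket g1 g2) phi (x t))) +
     lam t \<bullet> lie_bracket g1 g2 (x t)"

(* Since xi2 vanishes identically on the interval, so do its time derivatives; that the first of
   them vanishes is understood as the vanishing of the bracket, also where u1 = 0. *)
definition singular_arc ::
    "real \<Rightarrow> (real \<Rightarrow> real^2) \<Rightarrow> (real^3 \<Rightarrow> real^3) \<Rightarrow> (real^3 \<Rightarrow> real^3) \<Rightarrow> (real^3 \<Rightarrow> real^2) \<Rightarrow>
     real^2^2 \<Rightarrow> (real \<Rightarrow> real^3) \<Rightarrow> (real \<Rightarrow> real^2) \<Rightarrow> (real \<Rightarrow> real^3) \<Rightarrow> real set \<Rightarrow> bool" where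
  "singular_arc T yd g1 g2 phi M x u lam I \<longleftrightarrow>
     is_interval I \<and> I \<subseteq> {0..T} \<and> (\<exists>a\<in>I. \<exists>b\<in>I. a < b) \<and>
     (\<forall>t\<in>I. xi1 T yd g1 phi M x u lam t = 0 \<and> xi2 g2 x lam t = 0 \<and>
             xi2_dot_bracket T yd g1 g2 phi M x u lam t = 0)"

(* Row j, column i. *)
definition error_matrix :: "real^2^2 \<Rightarrow> real^2^2 \<Rightarrow> real^2^2" where
  "error_matrix Qbar M = (\<chi> j i. - (\<Sum>l\<in>UNIV. Qbar $ i $ l * matrix_inv M $ l $ j))"

end

(* On the singular arc the covector lam - e' M d(phi) annihilates g1, g2 and [g1,g2]. Flatness makes
   these three fields span the tangent space and d(phi) surjective, so lam = w d(phi) with w = M e',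
   and the costate equation turns into w' = Q e. As Q = Qbar M^-1 Qbar, the quantity s = w + Qbar e
   satisfies s' = Qbar M^-1 s, with s(T) = 0 by the terminal condition of the costate. Hence s = 0,
   which is M e' = - Qbar e.

   The spanning property is extracted from the flatness map F: prescribing polynomial outputs shows
   that F satisfies phi(x) = y, L_g1 phi(x) u1 = y' and the equation for y'' on the open set W.
   Differentiating the first two with respect to the jet gives that d(phi) is surjective and that
   L_g1 phi and its derivative along ker d(phi) are independent; the third excludes g2 = 0. *)
theory Submission
  imports Defs
begin

text \<open>The relation \<open>Q\<close> = \<open>Qbar\<close> \<open>M\<close>^-1
  \<open>Qbar\<close> is an algebraic Riccati equation solved by the terminal weight: twice the
  running cost equals s . \<open>M\<close>^-1 s - d/dt (e . \<open>Qbar\<close> e). This is why the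
  resulting law is linear with a constant matrix. Two obstacles shape the proof. First, s involves
  \<open>u\<close>, which is continuous only off a finite set, so the equation for s' is not
  directly available. On the arc the pullback of s by d(phi) equals lam + (\<open>Qbar\<close> e)
  d(phi), which is continuous on all of [0,T] and differentiable off a finite set. Surjectivity of
  d(phi), made uniform by compactness, bounds s by this pullback, and a Gronwall estimate replaces
  the solution of the linear equation. The value at T reaches the arc because T lies in the closure
  of \<open>I\<close>. Second, the length of the jet is arbitrary: y'' may be one of the arguments
  of the flatness map or may be absent from them, and the exclusion of g2 = 0 has to treat both
  cases.\<close>

section \<open>Second derivatives\<close>

text \<open>The second derivative at \<open>z\<close>, with \<open>h\<close> the direction of the
  outer differentiation and \<open>v\<close> that of the inner one. As an iterated derivative it is
  bilinear and symmetric only under the smoothness assumptions below.\<close>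

definition fd2 :: "('a::euclidean_space \<Rightarrow> 'b::real_normed_vector) \<Rightarrow> 'a \<Rightarrow> 'a \<Rightarrow> 'a \<Rightarrow> 'b" where
  "fd2 f z h v = frechet_derivative (\<lambda>y. frechet_derivative f (at y) v) (at z) h"

text \<open>\<open>Ck_on\<close> speaks of derivatives along \<open>Basis\<close> only; this
  expansion carries its information to arbitrary directions.\<close>

lemma frechet_derivative_Basis_expand:
  fixes f :: "'a::euclidean_space \<Rightarrow> 'b::real_normed_vector"
  assumes "f differentiable at z"
  shows "frechet_derivative f (at z) v = (\<Sum>b\<in>Basis. (v \<bullet> b) *\<^sub>R frechet_derivative f (at z) b)"
proof -
  interpret linear "frechet_derivative f (at z)"
    by (rule linear_frechet_derivative[OF assms])
  have "frechet_derivative f (at z) v = frechet_derivative f (at z) (\<Sum>b\<in>Basis. (v \<bullet> b) *\<^sub>R b)"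
    by (simp add: euclidean_representation)
  then show ?thesis by (simp add: sum scale)
qed

lemma Ck_on_Suc_has_derivative:
  assumes "open S" "Ck_on (Suc k) f S" "z \<in> S"
  shows "(f has_derivative frechet_derivative f (at z)) (at z)"
  using assms by (auto simp: differentiable_on_eq_differentiable_at frechet_derivative_works)

lemma fd2_has_derivative:
  assumes S: "open S" "Ck_on (Suc (Suc k)) f S" and z: "z \<in> S"
  shows "((\<lambda>y. frechet_derivative f (at y) v) has_derivative (\<lambda>h. fd2 f z h v)) (at z)"
proof -
  let ?g = "\<lambda>y. \<Sum>b\<in>Basis. (v \<bullet> b) *\<^sub>R frechet_derivative f (at y) b"
  have "?g differentiable at z"
    using S z by (auto intro!: differentiable_sum differentiable_scaleR 
      simp: differentiable_on_eq_differentiable_at)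
  then have "(?g has_derivative frechet_derivative ?g (at z)) (at z)"
    by (simp add: frechet_derivative_works)
  note g = this
  have "?g y = frechet_derivative f (at y) v" if "y \<in> S" for y
    using S that by (subst (2) frechet_derivative_Basis_expand) 
      (auto simp: differentiable_on_eq_differentiable_at)
  then have "((\<lambda>y. frechet_derivative f (at y) v) has_derivative frechet_derivative ?g (at z)) (at z)"
    by (rule has_derivative_transform_within_open[OF g S(1) z])
  note d = this
  show ?thesis
    unfolding fd2_def frechet_derivative_at[OF d, symmetric] by (rule d)
qed

lemma fd2_linear_left:
  assumes "open S" "Ck_on (Suc (Suc k)) f S" "z \<in> S"
  shows "linear (\<lambda>h. fd2 f z h v)"
  using has_derivative_linear[OF fd2_has_derivative[OF assms]] .

text \<open>The inner derivative is linear in \<open>v\<close> on all of the open set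
  \<open>S\<close>, so uniqueness of the outer derivative passes linearity on.\<close>

lemma fd2_linear_right:
  assumes S: "open S" "Ck_on (Suc (Suc k)) f S" and z: "z \<in> S"
  shows "linear (\<lambda>v. fd2 f z h v)"
proof -
  have lin: "linear (frechet_derivative f (at y))" if "y \<in> S" for y
    using S that by (intro linear_frechet_derivative) (auto simp: differentiable_on_eq_differentiable_at)
  note d = fd2_has_derivative[OF S z]
  have "fd2 f z h (v + w) = fd2 f z h v + fd2 f z h w" for v w
  proof -
    have "((\<lambda>y. frechet_derivative f (at y) (v + w)) has_derivative (\<lambda>h. fd2 f z h v + fd2 f z h w)) (at z)"
      by (rule has_derivative_transform_within_open[OF has_derivative_add[OF d d] S(1) z])
        (simp add: linear_add lin)
    from has_derivative_unique[OF d this] show ?thesis by (simp add: fun_eq_iff)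
  qed
  moreover have "fd2 f z h (c *\<^sub>R v) = c *\<^sub>R fd2 f z h v" for c v
  proof -
    have "((\<lambda>y. frechet_derivative f (at y) (c *\<^sub>R v)) has_derivative (\<lambda>h. c *\<^sub>R fd2 f z h v)) (at z)"
      by (rule has_derivative_transform_within_open[OF has_derivative_scaleR_right[OF d] S(1) z])
        (simp add: linear_scale lin)
    from has_derivative_unique[OF d this] show ?thesis by (simp add: fun_eq_iff)
  qed
  ultimately show ?thesis by (rule linearI)
qed

lemma fd2_Basis_expand:
  assumes S: "open S" "Ck_on (Suc (Suc k)) f S" and z: "z \<in> S"
  shows "fd2 f z h v = (\<Sum>b\<in>Basis. \<Sum>c\<in>Basis. ((v \<bullet> b) * (h \<bullet> c)) *\<^sub>R fd2 f z c b)"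
proof -
  note r = fd2_linear_right[OF S z]
  note l = fd2_linear_left[OF S z]
  have "fd2 f z h v = fd2 f z (\<Sum>c\<in>Basis. (h \<bullet> c) *\<^sub>R c) (\<Sum>b\<in>Basis. (v \<bullet> b) *\<^sub>R b)"
    by (simp add: euclidean_representation)
  also have "\<dots> = (\<Sum>b\<in>Basis. (v \<bullet> b) *\<^sub>R fd2 f z (\<Sum>c\<in>Basis. (h \<bullet> c) *\<^sub>R c) b)"
    by (subst linear_sum[OF r]) (simp add: linear_scale[OF r])
  also have "\<dots> = (\<Sum>b\<in>Basis. (v \<bullet> b) *\<^sub>R (\<Sum>c\<in>Basis. (h \<bullet> c) *\<^sub>R fd2 f z c b))"
    by (subst linear_sum[OF l]) (simp add: linear_scale[OF l])
  finally show ?thesis by (simp add: scaleR_sum_right)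
qed

text \<open>Bilinearity reduces moving directions to finitely many basis entries, each continuous by
  \<open>Ck_on\<close>.\<close>

lemma fd2_continuous_on:
  assumes S: "open S" "Ck_on (Suc (Suc k)) f S"
    and "continuous_on A g" "continuous_on A v" "continuous_on A h" "g ` A \<subseteq> S"
  shows "continuous_on A (\<lambda>z. fd2 f (g z) (h z) (v z))"
proof -
  have cont0: "continuous_on S F" if "Ck_on j F S" for j and F :: "'a \<Rightarrow> 'b"
    using that by (cases j) (auto intro: differentiable_imp_continuous_on)
  have *: "continuous_on S (\<lambda>z. fd2 f z c b)" if "b \<in> Basis" "c \<in> Basis" for b c
    using S(2) that cont0[of k] unfolding fd2_def by simp
  have "continuous_on A (\<lambda>z. \<Sum>b\<in>Basis. \<Sum>c\<in>Basis. ((v z \<bullet> b) * (h z \<bullet> c)) *\<^sub>R fd2 f (g z) c b)"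
    using assms(3-6) by (intro continuous_intros continuous_on_compose2[OF *]) auto
  then show ?thesis
    by (rule continuous_on_eq) (subst fd2_Basis_expand[OF S], use assms(6) in auto)
qed

lemma frechet_derivative_continuous_on:
  assumes S: "open S" "Ck_on (Suc k) f S"
    and "continuous_on A g" "continuous_on A v" "g ` A \<subseteq> S"
  shows "continuous_on A (\<lambda>z. frechet_derivative f (at (g z)) (v z))"
proof -
  have cont0: "continuous_on S F" if "Ck_on j F S" for j and F :: "'a \<Rightarrow> 'b"
    using that by (cases j) (auto intro: differentiable_imp_continuous_on)
  have *: "continuous_on S (\<lambda>z. frechet_derivative f (at z) b)" if "b \<in> Basis" for b
    using S(2) that cont0[of k] by simp
  have "continuous_on A (\<lambda>z. \<Sum>b\<in>Basis. (v z \<bullet> b) *\<^sub>R frechet_derivative f (at (g z)) b)"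
    using assms(3-5) by (intro continuous_intros continuous_on_compose2[OF *]) auto
  then show ?thesis
    by (rule continuous_on_eq) (subst frechet_derivative_Basis_expand,
      use assms(5) S in \<open>auto simp: differentiable_on_eq_differentiable_at\<close>)
qed

text \<open>Two applications of the one-dimensional mean value theorem, first along \<open>v\<close>, then along \<open>h\<close>.
  The left-hand side is symmetric in \<open>v\<close> and \<open>h\<close>.\<close>
lemma second_difference_mean_value:
  fixes f :: "'a::real_normed_vector \<Rightarrow> real"
  assumes ball: "cball z (s * (norm v + norm h)) \<subseteq> S" and s: "0 < s"
    and f: "\<And>y. y \<in> S \<Longrightarrow> (f has_derivative f' y) (at y)"
    and f': "\<And>y. y \<in> S \<Longrightarrow> ((\<lambda>y. f' y v) has_derivative f'' y) (at y)"
  shows "\<exists>y\<in>cball z (s * (norm v + norm h)).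
    f (z + s *\<^sub>R v + s *\<^sub>R h) - f (z + s *\<^sub>R v) - f (z + s *\<^sub>R h) + f z = s\<^sup>2 * f'' y h"
proof -
  have mem: "z + r *\<^sub>R v + q *\<^sub>R h \<in> cball z (s * (norm v + norm h))"
    if "0 \<le> r" "r \<le> s" "0 \<le> q" "q \<le> s" for r q
  proof -
    have "norm (r *\<^sub>R v + q *\<^sub>R h) \<le> r * norm v + q * norm h"
      using that by (intro norm_triangle_le) simp
    also have "\<dots> \<le> s * norm v + s * norm h"
      using that by (intro add_mono mult_right_mono) auto
    finally have "dist (z + r *\<^sub>R v + q *\<^sub>R h) z \<le> s * norm v + s * norm h"
      by (simp add: dist_norm add.assoc)
    then show ?thesis by (simp add: dist_commute distrib_left)
  qed
  have d: "((\<lambda>r. f (z + r *\<^sub>R v + q *\<^sub>R h)) has_real_derivative f' (z + r *\<^sub>R v + q *\<^sub>R h) v) (at r)"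
    if "0 \<le> r" "r \<le> s" "0 \<le> q" "q \<le> s" for r q
  proof -
    have S: "z + r *\<^sub>R v + q *\<^sub>R h \<in> S" using mem that ball by blast
    have "((\<lambda>r. z + r *\<^sub>R v + q *\<^sub>R h) has_derivative (\<lambda>r. r *\<^sub>R v)) (at r)"
      by (auto intro!: derivative_eq_intros)
    from has_derivative_compose[OF this f[OF S]]
    show ?thesis
      using linear_scale[OF has_derivative_linear[OF f[OF S]]]
      by (simp add: has_field_derivative_def mult_commute_abs)
  qed
  have "\<exists>r>0. r < s \<and> (f (z + s *\<^sub>R v + s *\<^sub>R h) - f (z + s *\<^sub>R v + 0 *\<^sub>R h)) - (f (z + 0 *\<^sub>R v + s *\<^sub>R h) - f (z + 0 *\<^sub>R v + 0 *\<^sub>R h))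
      = (s - 0) * (f' (z + r *\<^sub>R v + s *\<^sub>R h) v - f' (z + r *\<^sub>R v + 0 *\<^sub>R h) v)"
    using s by (intro MVT2 DERIV_diff d) auto
  then obtain r where r: "0 < r" "r < s"
    and 1: "f (z + s *\<^sub>R v + s *\<^sub>R h) - f (z + s *\<^sub>R v) - f (z + s *\<^sub>R h) + f z
      = s * (f' (z + r *\<^sub>R v + s *\<^sub>R h) v - f' (z + r *\<^sub>R v) v)"
    by auto
  have d': "((\<lambda>q. f' (z + r *\<^sub>R v + q *\<^sub>R h) v) has_real_derivative f'' (z + r *\<^sub>R v + q *\<^sub>R h) h) (at q)"
    if "0 \<le> q" "q \<le> s" for q
  proof -
    have S: "z + r *\<^sub>R v + q *\<^sub>R h \<in> S" using mem that r ball by (meson less_imp_le subsetD)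
    have "((\<lambda>q. z + r *\<^sub>R v + q *\<^sub>R h) has_derivative (\<lambda>q. q *\<^sub>R h)) (at q)"
      by (auto intro!: derivative_eq_intros)
    from has_derivative_compose[OF this f'[OF S]]
    show ?thesis
      using linear_scale[OF has_derivative_linear[OF f'[OF S]]]
      by (simp add: has_field_derivative_def mult_commute_abs)
  qed
  have "\<exists>q>0. q < s \<and> f' (z + r *\<^sub>R v + s *\<^sub>R h) v - f' (z + r *\<^sub>R v + 0 *\<^sub>R h) v
     = (s - 0) * f'' (z + r *\<^sub>R v + q *\<^sub>R h) h"
    using s by (intro MVT2 d') auto
  then obtain q where q: "0 < q" "q < s"
    and 2: "f' (z + r *\<^sub>R v + s *\<^sub>R h) v - f' (z + r *\<^sub>R v) v = s * f'' (z + r *\<^sub>R v + q *\<^sub>R h) h"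
    by auto
  show ?thesis
    using mem[of r q] r q unfolding 1 2 by (auto simp: power2_eq_square)
qed

text \<open>One and the same second difference equals \<open>s\<close>^2 times either mixed
  derivative at points near \<open>z\<close>. If the two differed at \<open>z\<close>, continuity
  would keep their nearby values apart; \<open>e\<close> is half the gap.\<close>

lemma second_derivative_symmetric:
  fixes f :: "'a::real_normed_vector \<Rightarrow> real"
  assumes S: "open S" "z \<in> S"
    and f: "\<And>y. y \<in> S \<Longrightarrow> (f has_derivative f' y) (at y)"
    and fv: "\<And>y. y \<in> S \<Longrightarrow> ((\<lambda>y. f' y v) has_derivative fv y) (at y)"
    and fh: "\<And>y. y \<in> S \<Longrightarrow> ((\<lambda>y. f' y h) has_derivative fh y) (at y)"
    and cont: "continuous_on S (\<lambda>y. fv y h)" "continuous_on S (\<lambda>y. fh y v)"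
  shows "fv z h = fh z v"
proof (rule ccontr)
  assume ne: "fv z h \<noteq> fh z v"
  define e where "e = \<bar>fv z h - fh z v\<bar> / 2"
  have e: "e > 0" using ne by (simp add: e_def)
  have "\<forall>\<^sub>F y in nhds z. y \<in> S \<and> \<bar>fv y h - fv z h\<bar> < e \<and> \<bar>fh y v - fh z v\<bar> < e"
  proof (intro eventually_conj)
    show "\<forall>\<^sub>F y in nhds z. y \<in> S" using S eventually_nhds by blast
    have "isCont (\<lambda>y. fv y h) z" "isCont (\<lambda>y. fh y v) z"
      using cont S by (auto simp: continuous_on_eq_continuous_at)
    then have "\<forall>\<^sub>F y in at z. dist (fv y h) (fv z h) < e" "\<forall>\<^sub>F y in at z. dist (fh y v) (fh z v) < e"
      by (auto intro!: tendstoD e simp: isCont_def)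
    then show "\<forall>\<^sub>F y in nhds z. \<bar>fv y h - fv z h\<bar> < e" "\<forall>\<^sub>F y in nhds z. \<bar>fh y v - fh z v\<bar> < e"
      using e by (simp_all add: eventually_nhds_conv_at dist_real_def)
  qed
  then obtain r where r: "r > 0"
    and R: "\<And>y. dist y z \<le> r \<Longrightarrow> y \<in> S \<and> \<bar>fv y h - fv z h\<bar> < e \<and> \<bar>fh y v - fh z v\<bar> < e"
    by (auto simp: eventually_nhds_metric_le)
  \<comment> \<open>The summand 1 keeps the denominator positive when \<open>v\<close> and
    \<open>h\<close> both vanish.\<close>
  define s where "s = r / (norm v + norm h + 1)"
  have pos: "0 < norm v + norm h + 1"
    by (smt (verit) norm_ge_zero)
  then have s: "s > 0" using r by (simp add: s_def)
  have le: "s * (norm v + norm h) \<le> r"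
    using pos r by (simp add: s_def field_simps)
  have sub: "cball z (s * (norm v + norm h)) \<subseteq> S" "cball z (s * (norm h + norm v)) \<subseteq> S"
    using R le by (auto simp: dist_commute add.commute)
  obtain y where y: "y \<in> cball z (s * (norm v + norm h))"
    and 1: "f (z + s *\<^sub>R v + s *\<^sub>R h) - f (z + s *\<^sub>R v) - f (z + s *\<^sub>R h) + f z = s\<^sup>2 * fv y h"
    using second_difference_mean_value[OF sub(1) s f fv] by auto
  obtain y' where y': "y' \<in> cball z (s * (norm h + norm v))"
    and 2: "f (z + s *\<^sub>R h + s *\<^sub>R v) - f (z + s *\<^sub>R h) - f (z + s *\<^sub>R v) + f z = s\<^sup>2 * fh y' v"
    using second_difference_mean_value[OF sub(2) s f fh] by auto
  have "s\<^sup>2 * fv y h = s\<^sup>2 * fh y' v"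
    using 1 2 by (simp add: algebra_simps)
  then have "fv y h = fh y' v" using s by simp
  moreover have "\<bar>fv y h - fv z h\<bar> < e" "\<bar>fh y' v - fh z v\<bar> < e"
    using R[of y] R[of y'] y y' le by (auto simp: dist_commute add.commute)
  ultimately show False
    using e by (simp add: e_def abs_if split: if_splits)
qed

text \<open>Taken component by component, since the mean value argument is for real-valued
  functions.\<close>

lemma fd2_symmetric:
  fixes f :: "'a::euclidean_space \<Rightarrow> 'b::euclidean_space"
  assumes S: "open S" "Ck_on (Suc (Suc k)) f S" and z: "z \<in> S"
  shows "fd2 f z h v = fd2 f z v h"
proof (rule euclidean_eqI)
  fix b :: 'b
  have cont: "continuous_on S (\<lambda>y. fd2 f y h v \<bullet> b)" for h v
    by (intro continuous_intros fd2_continuous_on[OF S]) auto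
  show "fd2 f z h v \<bullet> b = fd2 f z v h \<bullet> b"
  proof (rule second_derivative_symmetric[where f = "\<lambda>y. f y \<bullet> b" 
      and f' = "\<lambda>y k. frechet_derivative f (at y) k \<bullet> b" and fv = "\<lambda>y k. fd2 f y k v \<bullet> b" 
      and fh = "\<lambda>y k. fd2 f y k h \<bullet> b", OF S(1) z])
    fix y assume y: "y \<in> S"
    show "((\<lambda>y. f y \<bullet> b) has_derivative (\<lambda>k. frechet_derivative f (at y) k \<bullet> b)) (at y)"
      by (intro has_derivative_inner_left Ck_on_Suc_has_derivative[OF S y])
    show "((\<lambda>y. frechet_derivative f (at y) v \<bullet> b) has_derivative (\<lambda>k. fd2 f y k v \<bullet> b)) (at y)"
      "((\<lambda>y. frechet_derivative f (at y) h \<bullet> b) has_derivative (\<lambda>k. fd2 f y k h \<bullet> b)) (at y)"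
      by (intro has_derivative_inner_left fd2_has_derivative[OF S y])+
  qed (rule cont)+
qed

text \<open>A product rule: base point and direction both move. For \<open>phi\<close> and
  \<open>g1\<close> it differentiates the Lie derivative of the output.\<close>

lemma frechet_derivative_field_has_derivative:
  assumes S: "open S" "Ck_on (Suc (Suc k)) f S" and z: "z \<in> S"
    and g: "(g has_derivative g') (at z)"
  shows "((\<lambda>y. frechet_derivative f (at y) (g y)) has_derivative
    (\<lambda>h. fd2 f z h (g z) + frechet_derivative f (at z) (g' h))) (at z)"
proof -
  have df: "f differentiable at y" if "y \<in> S" for y
    using S that by (auto simp: differentiable_on_eq_differentiable_at)
  have "((\<lambda>y. \<Sum>b\<in>Basis. (g y \<bullet> b) *\<^sub>R frechet_derivative f (at y) b) has_derivative
    (\<lambda>h. \<Sum>b\<in>Basis. (g z \<bullet> b) *\<^sub>R fd2 f z h b + (g' h \<bullet> b) *\<^sub>R frechet_derivative f (at z) b)) (at z)"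
    by (intro has_derivative_sum has_derivative_scaleR fd2_has_derivative[OF S z] has_derivative_inner_left g)
  also have "(\<lambda>h. \<Sum>b\<in>Basis. (g z \<bullet> b) *\<^sub>R fd2 f z h b + (g' h \<bullet> b) *\<^sub>R frechet_derivative f (at z) b)
      = (\<lambda>h. fd2 f z h (g z) + frechet_derivative f (at z) (g' h))"
  proof
    fix h
    note r = fd2_linear_right[OF S z]
    have "fd2 f z h (g z) = fd2 f z h (\<Sum>b\<in>Basis. (g z \<bullet> b) *\<^sub>R b)"
      by (simp add: euclidean_representation)
    also have "\<dots> = (\<Sum>b\<in>Basis. (g z \<bullet> b) *\<^sub>R fd2 f z h b)"
      by (subst linear_sum[OF r]) (simp add: linear_scale[OF r])
    finally show "(\<Sum>b\<in>Basis. (g z \<bullet> b) *\<^sub>R fd2 f z h b + (g' h \<bullet> b) *\<^sub>R frechet_derivative f (at z) b)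
      = fd2 f z h (g z) + frechet_derivative f (at z) (g' h)"
      by (simp add: sum.distrib frechet_derivative_Basis_expand[OF df[OF z], of "g' h"])
  qed
  finally show ?thesis
    by (rule has_derivative_transform_within_open[OF _ S(1) z])
      (simp add: frechet_derivative_Basis_expand[OF df])
qed

section \<open>Jets of polynomial curves\<close>

text \<open>Normalised so that \<open>c k\<close> is the derivative of order \<open>k\<close> at 0
  for \<open>k < n\<close>; differentiation then merely shifts the coefficients.\<close>

definition taylor_curve :: "nat \<Rightarrow> (nat \<Rightarrow> 'a::real_normed_vector) \<Rightarrow> real \<Rightarrow> 'a" where
  "taylor_curve n c t = (\<Sum>k<n. (t ^ k / fact k) *\<^sub>R c k)"

lemma taylor_curve_has_vector_derivative:
  "(taylor_curve n c has_vector_derivative taylor_curve (n - 1) (\<lambda>k. c (Suc k)) t) (at t)"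
proof (cases n)
  case 0
  then show ?thesis by (simp add: taylor_curve_def[abs_def])
next
  case (Suc m)
  have eq: "taylor_curve n c = (\<lambda>t. c 0 + (\<Sum>k<m. (t ^ Suc k / fact (Suc k)) *\<^sub>R c (Suc k)))"
    unfolding taylor_curve_def Suc sum.lessThan_Suc_shift by simp
  have d: "((\<lambda>t. t ^ Suc k / fact (Suc k)) has_vector_derivative t ^ k / fact k) (at t)" for k
  proof -
    have "((\<lambda>t::real. t ^ Suc k / fact (Suc k)) has_real_derivative real (Suc k) * t ^ k / fact (Suc k)) (at t)"
      by (auto intro!: derivative_eq_intros simp del: power_Suc fact_Suc)
    moreover have "real (Suc k) * t ^ k / fact (Suc k) = t ^ k / fact k"
      by (simp del: of_nat_Suc)
    ultimately show ?thesis
      by (simp add: has_real_derivative_iff_has_vector_derivative)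
  qed
  have "((\<lambda>t. c 0 + (\<Sum>k<m. (t ^ Suc k / fact (Suc k)) *\<^sub>R c (Suc k))) has_vector_derivative
      0 + (\<Sum>k<m. (t ^ k / fact k) *\<^sub>R c (Suc k))) (at t)"
  proof (intro has_vector_derivative_add has_vector_derivative_const has_vector_derivative_sum)
    fix k
    show "((\<lambda>t. (t ^ Suc k / fact (Suc k)) *\<^sub>R c (Suc k)) has_vector_derivative (t ^ k / fact k) *\<^sub>R c (Suc k)) (at t)"
      using bounded_linear.has_vector_derivative[OF bounded_linear_scaleR_left d] .
  qed
  then show ?thesis by (simp add: eq) (simp add: Suc taylor_curve_def)
qed

lemma taylor_curve_0: "taylor_curve n c 0 = (if n = 0 then 0 else c 0)"
  unfolding taylor_curve_def by (cases n) (simp_all add: sum.lessThan_Suc_shift del: sum.lessThan_Suc)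

lemma smooth_on_taylor_curve: "smooth_on S (taylor_curve n c)"
proof -
  have "Ck_on k (taylor_curve n c) S" for k
  proof (induction k arbitrary: n c)
    case 0
    show ?case
      using taylor_curve_has_vector_derivative[of n c]
      by (auto intro!: continuous_at_imp_continuous_on has_vector_derivative_continuous)
  next
    case (Suc k)
    have d: "(taylor_curve n c has_derivative (\<lambda>h. h *\<^sub>R taylor_curve (n - 1) (\<lambda>k. c (Suc k)) t)) (at t)" for t
      using taylor_curve_has_vector_derivative[of n c t] by (simp add: has_vector_derivative_def)
    have "taylor_curve n c differentiable_on S"
      unfolding differentiable_on_def differentiable_def
      using d has_derivative_at_withinI by blast
    moreover have "frechet_derivative (taylor_curve n c) (at t) 1 = taylor_curve (n - 1) (\<lambda>k. c (Suc k)) t" for t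
      by (simp flip: frechet_derivative_at[OF d])
    ultimately show ?case using Suc by simp
  qed
  then show ?thesis by (simp add: smooth_on_def)
qed

lemma iterated_vector_derivative_taylor_curve:
  "((\<lambda>f s. vector_derivative f (at s)) ^^ m) (taylor_curve n c) = taylor_curve (n - m) (\<lambda>k. c (k + m))"
proof (induction m)
  case (Suc m)
  show ?case
    unfolding funpow.simps o_def Suc
    by (rule ext, rule vector_derivative_at)
      (use taylor_curve_has_vector_derivative[of "n - m" "\<lambda>k. c (k + m)"] in simp)
qed simp

lemma to_nat_on_UNIV_less: "to_nat_on (UNIV :: 'r::finite set) k < CARD('r)"
  using bij_betw_apply[OF to_nat_on_finite[of "UNIV :: 'r set"], of k] by simp

text \<open>Every jet is thus attained at time 0 by a polynomial, which turns statements about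
  curves into identities on the jet space.\<close>

lemma jet_taylor_curve_0:
  assumes "CARD('r::finite) \<le> n"
  shows "jet (taylor_curve n c) 0 = (\<chi> k :: 'r. c (to_nat_on UNIV k))"
proof -
  have "to_nat_on (UNIV :: 'r set) k < n" for k
    using to_nat_on_UNIV_less assms by (rule less_le_trans)
  then show ?thesis
    by (auto simp: jet_def iterated_vector_derivative_taylor_curve taylor_curve_0 vec_eq_iff
        simp flip: not_less)
qed

lemma isCont_jet_taylor_curve: "isCont (jet (taylor_curve n c) :: real \<Rightarrow> real^2^'r::finite) t"
  unfolding jet_def iterated_vector_derivative_taylor_curve
  unfolding isCont_def
  by (intro tendsto_vec_lambda isContD has_vector_derivative_continuous[OF taylor_curve_has_vector_derivative])

section \<open>Vector fields in coordinates\<close>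

lemma lie_deriv_vec_eq:
  fixes f :: "real^'n \<Rightarrow> real^'m"
  assumes "f differentiable at z"
  shows "lie_deriv_vec g f z = frechet_derivative f (at z) (g z)"
proof -
  have d: "(f has_derivative frechet_derivative f (at z)) (at z)"
    using assms by (simp add: frechet_derivative_works)
  have c: "frechet_derivative (\<lambda>y. f y $ i) (at z) = (\<lambda>h. frechet_derivative f (at z) h $ i)" for i
    using frechet_derivative_at[OF bounded_linear.has_derivative[OF bounded_linear_vec_nth d]] by simp
  have "frechet_derivative f (at z) (g z) = (\<Sum>k\<in>UNIV. g z $ k *\<^sub>R frechet_derivative f (at z) (axis k 1))"
  proof -
    interpret linear "frechet_derivative f (at z)"
      by (rule linear_frechet_derivative[OF assms])
    have "frechet_derivative f (at z) (g z) = frechet_derivative f (at z) (\<Sum>k\<in>UNIV. g z $ k *\<^sub>R axis k 1)"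
      by (simp add: basis_expansion flip: scalar_mult_eq_scaleR)
    then show ?thesis by (simp add: sum scale)
  qed
  then show ?thesis
    by (simp add: vec_eq_iff lie_deriv_vec_def lie_deriv_def partial_def c)
qed

lemma partial_vec_eq:
  fixes f :: "real^'n \<Rightarrow> real^'m"
  assumes "f differentiable at z"
  shows "partial_vec k f z = frechet_derivative f (at z) (axis k 1)"
proof -
  have d: "(f has_derivative frechet_derivative f (at z)) (at z)"
    using assms by (simp add: frechet_derivative_works)
  have c: "frechet_derivative (\<lambda>y. f y $ i) (at z) = (\<lambda>h. frechet_derivative f (at z) h $ i)" for i
    using frechet_derivative_at[OF bounded_linear.has_derivative[OF bounded_linear_vec_nth d]] by simp
  show ?thesis by (simp add: vec_eq_iff partial_vec_def partial_def c)
qed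

lemma lie_bracket_eq:
  assumes "g1 differentiable at z" "g2 differentiable at z"
  shows "lie_bracket g1 g2 z = frechet_derivative g2 (at z) (g1 z) - frechet_derivative g1 (at z) (g2 z)"
  unfolding lie_deriv_vec_eq[OF assms(1), symmetric] lie_deriv_vec_eq[OF assms(2), symmetric]
  by (simp add: vec_eq_iff lie_bracket_def lie_deriv_vec_def lie_deriv_def sum_subtractf)

section \<open>Flatness and the spanning property\<close>

lemma not_all_multiples_of_one_vector: "\<not> (\<forall>v::real^2. \<exists>b. v = b *\<^sub>R a)"
proof
  assume all: "\<forall>v::real^2. \<exists>b. v = b *\<^sub>R a"
  obtain b c where b: "axis 1 1 = b *\<^sub>R a" and c: "axis 2 1 = c *\<^sub>R a"
    using all by meson
  have "b * a $ 1 = 1" "b * a $ 2 = 0" "c * a $ 1 = 0" "c * a $ 2 = 1"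
    using arg_cong[OF b, of "\<lambda>v. v $ 1"] arg_cong[OF b, of "\<lambda>v. v $ 2"]
      arg_cong[OF c, of "\<lambda>v. v $ 1"] arg_cong[OF c, of "\<lambda>v. v $ 2"]
    by (simp_all add: axis_def)
  then show False by (metis mult_eq_0_iff zero_neq_one)
qed

text \<open>A nontrivial relation would make one vector a multiple of the other, and a line would
  fill the plane.\<close>

lemma spanning_pair_independent:
  fixes p w :: "real^2"
  assumes span: "\<And>v. \<exists>b c. v = b *\<^sub>R p + c *\<^sub>R w" and eq: "b *\<^sub>R p + c *\<^sub>R w = 0"
  shows "b = 0 \<and> c = 0"
proof (rule ccontr)
  assume "\<not> (b = 0 \<and> c = 0)"
  then consider "b \<noteq> 0" | "c \<noteq> 0" by blast
  then show False
  proof cases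
    case 1
    have "b *\<^sub>R p = (- c) *\<^sub>R w" using eq by (simp add: add_eq_0_iff)
    then have "(1 / b) *\<^sub>R (b *\<^sub>R p) = (1 / b) *\<^sub>R ((- c) *\<^sub>R w)" by simp
    then have "p = (- c / b) *\<^sub>R w" using 1 by simp
    then have "\<forall>v. \<exists>b. v = b *\<^sub>R w" using span by (metis scaleR_add_left scaleR_scaleR)
    then show False using not_all_multiples_of_one_vector by blast
  next
    case 2
    have "c *\<^sub>R w = (- b) *\<^sub>R p" using eq by (simp add: add_eq_0_iff2)
    then have "(1 / c) *\<^sub>R (c *\<^sub>R w) = (1 / c) *\<^sub>R ((- b) *\<^sub>R p)" by simp
    then have "w = (- b / c) *\<^sub>R p" using 2 by simp
    then have "\<forall>v. \<exists>b. v = b *\<^sub>R p" using span by (metis scaleR_add_left scaleR_scaleR)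
    then show False using not_all_multiples_of_one_vector by blast
  qed
qed

text \<open>Two independent kernel vectors and the two-dimensional range of a right inverse
  \<open>G\<close> meet only in 0, so together they would need four dimensions.\<close>

lemma kernel_one_dimensional:
  fixes D :: "real^3 \<Rightarrow> real^2"
  assumes D: "linear D" "surj D" and k: "D k = 0" "k \<noteq> 0" and h: "D h = 0"
  shows "\<exists>s. h = s *\<^sub>R k"
proof (rule ccontr)
  assume "\<not> ?thesis"
  then have "h \<notin> span {k}" by (auto simp: span_singleton)
  then have "independent {h, k}" "h \<noteq> k"
    using k by (auto simp: independent_insert span_base)
  then have dim2: "dim (span {h, k}) = 2"
    by (simp add: dim_eq_card_independent)
  obtain G where G: "linear G" "D \<circ> G = id"
    using linear_surjective_right_inverse[OF D] by auto
  then have DG: "D (G v) = v" for v by (metis comp_apply id_apply)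
  then have "inj G" by (metis injI)
  then have dimG: "dim (range G) = 2"
    using dim_image_eq[OF G(1), of UNIV] by simp
  have "D z = 0" if "z \<in> span {h, k}" for z
    using that by (induction rule: span_induct)
      (auto simp: subspace_def linear_0[OF D(1)] linear_add[OF D(1)] linear_scale[OF D(1)] k h)
  then have "G v = 0" if "G v \<in> span {h, k}" for v
    using DG[of v] that linear_0[OF G(1)] by simp
  then have "span {h, k} \<inter> range G \<subseteq> {0}"
    by blast
  then have "dim (span {h, k} \<inter> range G) = 0"
    by simp
  moreover have "dim {x + y |x y. x \<in> span {h, k} \<and> y \<in> range G} \<le> DIM(real^3)"
    by (rule dim_subset_UNIV)
  ultimately show False
    using dim_sums_Int[of "span {h, k}" "range G"] linear_subspace_image[OF G(1) subspace_UNIV] dim2 dimG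
    by (simp del: dim_eq_0)
qed

text \<open>The identity \<open>phi (x t) = y t\<close> and its first two time derivatives, taken at
  0 along the polynomial output with jet \<open>j\<close>. Coefficients of \<open>c\<close> beyond
  the jet are arbitrary. The unknown \<open>b\<close> is the time derivative of the first
  input.\<close>

lemma flat_jet_equations:
  fixes F :: "real^2^'r::finite \<Rightarrow> (real^3) \<times> (real^2)"
  defines "X \<equiv> \<lambda>j. fst (F j)" and "V \<equiv> \<lambda>j. snd (F j)"
  assumes U: "open U" and phi: "Ck_on (Suc (Suc 0)) phi U" and g1: "Ck_on (Suc 0) g1 U"
    and annih: "\<forall>z\<in>U. frechet_derivative phi (at z) (g2 z) = 0"
    and W: "open W" and j: "j \<in> W"
    and free: "\<forall>a b y. smooth_on {a<..<b} y \<longrightarrow> (\<forall>t\<in>{a<..<b}. jet y t \<in> W) \<longrightarrow>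
        smooth_solution U g1 g2 {a<..<b} (\<lambda>t. fst (F (jet y t))) (\<lambda>t. snd (F (jet y t))) \<and>
        (\<forall>t\<in>{a<..<b}. phi (fst (F (jet y t))) = y t)"
    and c: "\<And>k. c (to_nat_on UNIV k) = j $ k"
  shows "X j \<in> U" and "phi (X j) = c 0"
    and "c 1 = V j $ 1 *\<^sub>R frechet_derivative phi (at (X j)) (g1 (X j))"
    and "\<exists>b. c 2 = b *\<^sub>R frechet_derivative phi (at (X j)) (g1 (X j)) +
      V j $ 1 *\<^sub>R (fd2 phi (X j) (driftless g1 g2 (X j) (V j)) (g1 (X j)) +
        frechet_derivative phi (at (X j)) (frechet_derivative g1 (at (X j)) (driftless g1 g2 (X j) (V j))))"
proof -
  \<comment> \<open>The surplus makes \<open>c 0\<close>, \<open>c 1\<close> and \<open>c 2\<close>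
    all occur, however short the jet is.\<close>
  define n where "n = CARD('r) + 3"
  define y where "y = taylor_curve n c"
  define y1 where "y1 = taylor_curve (n - 1) (\<lambda>k. c (Suc k))"
  have y': "(y has_vector_derivative y1 t) (at t)" for t
    unfolding y_def y1_def by (rule taylor_curve_has_vector_derivative)
  have y1': "(y1 has_vector_derivative c 2) (at 0)"
    using taylor_curve_has_vector_derivative[of "n - 1" "\<lambda>k. c (Suc k)" 0]
    by (simp add: y1_def taylor_curve_0 n_def numeral_2_eq_2)
  have y0: "y 0 = c 0" "y1 0 = c 1"
    by (simp_all add: y_def y1_def taylor_curve_0 n_def)
  have jet0: "jet y 0 = j"
    by (simp add: y_def jet_taylor_curve_0 n_def c)
  \<comment> \<open>Only the jet at time 0 is known to lie in \<open>W\<close>; continuity supplies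
    an interval on which \<open>free\<close> applies.\<close>
  have "isCont (jet y :: real \<Rightarrow> real^2^'r) 0"
    unfolding y_def by (rule isCont_jet_taylor_curve)
  then obtain N where N: "open N" "0 \<in> N" "\<And>t. t \<in> N \<Longrightarrow> jet y t \<in> W"
    using W j jet0 unfolding continuous_at_open by metis
  then obtain e where "e > 0" "ball 0 e \<subseteq> N"
    using open_contains_ball by metis
  then have e: "e > 0" "\<And>t. \<bar>t\<bar> < e \<Longrightarrow> jet y t \<in> W"
    using N(3) by (auto simp: subset_iff)
  define J where "J = {-e<..<e}"
  have J: "open J" "0 \<in> J" using e by (auto simp: J_def)
  define x where "x = (\<lambda>t. X (jet y t))"
  define u where "u = (\<lambda>t. V (jet y t))"
  have "smooth_solution U g1 g2 J x u \<and> (\<forall>t\<in>J. phi (x t) = y t)"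
    unfolding J_def x_def u_def X_def V_def
    by (rule free[rule_format]) (auto simp: y_def smooth_on_taylor_curve e(2)[unfolded y_def] abs_less_iff)
  then have sol: "\<And>t. t \<in> J \<Longrightarrow> x t \<in> U"
      "\<And>t. t \<in> J \<Longrightarrow> (x has_vector_derivative driftless g1 g2 (x t) (u t)) (at t)"
      "smooth_on J u" "\<And>t. t \<in> J \<Longrightarrow> phi (x t) = y t"
    by (auto simp: smooth_solution_def)
  let ?D = "\<lambda>z. frechet_derivative phi (at z)"
  have lin: "linear (?D z)" if "z \<in> U" for z
    using has_derivative_linear[OF Ck_on_Suc_has_derivative[OF U phi that]] .
  have y1: "y1 t = u t $ 1 *\<^sub>R ?D (x t) (g1 (x t))" if t: "t \<in> J" for t
  proof -
    have "((phi \<circ> x) has_vector_derivative ?D (x t) (driftless g1 g2 (x t) (u t))) (at t)"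
      by (rule vector_derivative_diff_chain_within[OF sol(2)[OF t]])
        (rule has_derivative_at_withinI[OF Ck_on_Suc_has_derivative[OF U phi sol(1)[OF t]]])
    then have "(y has_vector_derivative ?D (x t) (driftless g1 g2 (x t) (u t))) (at t)"
      by (rule has_vector_derivative_transform_within_open[OF _ J(1) t]) (simp add: sol)
    from vector_derivative_unique_at[OF y' this] show ?thesis
      using lin[OF sol(1)[OF t]] bspec[OF annih sol(1)[OF t]]
      by (simp add: driftless_def linear_add linear_scale)
  qed
  have x0: "x 0 = X j" "u 0 = V j" by (simp_all add: x_def u_def jet0)
  show U0: "X j \<in> U" and "phi (X j) = c 0"
    using sol(1)[OF J(2)] sol(4)[OF J(2)] by (simp_all add: x0 y0)
  show "c 1 = V j $ 1 *\<^sub>R ?D (X j) (g1 (X j))"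
    using y1[OF J(2)] by (simp add: x0 y0)
  let ?x' = "driftless g1 g2 (X j) (V j)"
  have "Ck_on (Suc 0) u J" using sol(3) by (simp add: smooth_on_def)
  from Ck_on_Suc_has_derivative[OF J(1) this J(2)]
  obtain u' where u': "(u has_vector_derivative u') (at 0)"
    by (metis differentiableI vector_derivative_works)
  have u1: "((\<lambda>t. u t $ 1) has_vector_derivative u' $ 1) (at 0)"
    using bounded_linear.has_vector_derivative[OF bounded_linear_vec_nth u'] .
  have x': "(x has_vector_derivative ?x') (at 0)" using sol(2)[OF J(2)] by (simp add: x0)
  have a: "((\<lambda>z. ?D z (g1 z)) has_derivative (\<lambda>h. fd2 phi (X j) h (g1 (X j)) +
      ?D (X j) (frechet_derivative g1 (at (X j)) h))) (at (x 0))"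
    unfolding x0
    by (rule frechet_derivative_field_has_derivative[OF U phi U0 Ck_on_Suc_has_derivative[OF U g1 U0]])
  have ax: "((\<lambda>t. ?D (x t) (g1 (x t))) has_vector_derivative fd2 phi (X j) ?x' (g1 (X j)) +
      ?D (X j) (frechet_derivative g1 (at (X j)) ?x')) (at 0)"
    using vector_derivative_diff_chain_within[OF x' has_derivative_at_withinI[OF a]] by (simp add: o_def)
  have "((\<lambda>t. u t $ 1 *\<^sub>R ?D (x t) (g1 (x t))) has_vector_derivative
      u 0 $ 1 *\<^sub>R (fd2 phi (X j) ?x' (g1 (X j)) + ?D (X j) (frechet_derivative g1 (at (X j)) ?x')) +
      u' $ 1 *\<^sub>R ?D (x 0) (g1 (x 0))) (at 0)"
    by (rule has_vector_derivative_scaleR[OF _ ax])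
      (use u1 in \<open>simp add: has_real_derivative_iff_has_vector_derivative\<close>)
  then have "(y1 has_vector_derivative
      u 0 $ 1 *\<^sub>R (fd2 phi (X j) ?x' (g1 (X j)) + ?D (X j) (frechet_derivative g1 (at (X j)) ?x')) +
      u' $ 1 *\<^sub>R ?D (x 0) (g1 (x 0))) (at 0)"
    by (rule has_vector_derivative_transform_within_open[OF _ J]) (simp add: y1)
  from vector_derivative_unique_at[OF y1' this]
  show "\<exists>b. c 2 = b *\<^sub>R ?D (X j) (g1 (X j)) + V j $ 1 *\<^sub>R (fd2 phi (X j) ?x' (g1 (X j)) +
      ?D (X j) (frechet_derivative g1 (at (X j)) ?x'))"
    by (metis add.commute x0)
qed

text \<open>The kernel of d(phi) is a line, spanned by \<open>g2\<close> once \<open>g2\<close> is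
  nonzero. Modulo this line, \<open>g1\<close> and the bracket map to \<open>a\<close> and
  \<open>- Da (g2)\<close>, which span the plane. Hence \<open>mu\<close>, read as a vector, is a
  combination of the three fields and orthogonal to itself.\<close>

lemma x_flat_output_at_regular:
  fixes phi :: "real^3 \<Rightarrow> real^2"
  assumes U: "open U" and phi: "Ck_on (Suc (Suc 0)) phi U"
    and g1: "Ck_on (Suc 0) g1 U" and g2: "Ck_on (Suc 0) g2 U"
    and annih: "\<forall>z\<in>U. frechet_derivative phi (at z) (g2 z) = 0"
    and flat: "x_flat_output_at TYPE('r::finite) U g1 g2 phi x0"
  shows "surj (frechet_derivative phi (at x0))"
    and "mu \<bullet> g1 x0 = 0 \<Longrightarrow> mu \<bullet> g2 x0 = 0 \<Longrightarrow> mu \<bullet> lie_bracket g1 g2 x0 = 0 \<Longrightarrow> mu = 0"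
proof -
  from flat obtain F :: "real^2^'r \<Rightarrow> (real^3) \<times> (real^2)" and W u0
    where W: "open W" and F: "smooth_on W F" and x0W: "(x0, u0) \<in> F ` W"
    and free: "\<forall>a b y. smooth_on {a<..<b} y \<longrightarrow> (\<forall>t\<in>{a<..<b}. jet y t \<in> W) \<longrightarrow>
        smooth_solution U g1 g2 {a<..<b} (\<lambda>t. fst (F (jet y t))) (\<lambda>t. snd (F (jet y t))) \<and>
        (\<forall>t\<in>{a<..<b}. phi (fst (F (jet y t))) = y t)"
    unfolding x_flat_output_at_def by blast
  obtain j0 where j0: "j0 \<in> W" "F j0 = (x0, u0)" using x0W by auto
  define X where "X = (\<lambda>j. fst (F j))"
  define V where "V = (\<lambda>j. snd (F j) $ 1)"
  define D where "D = (\<lambda>z. frechet_derivative phi (at z))"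
  define a where "a = (\<lambda>z. D z (g1 z))"
  define Da where "Da = (\<lambda>z h. fd2 phi z h (g1 z) + D z (frechet_derivative g1 (at z) h))"
  have X0: "X j0 = x0" by (simp add: X_def j0)
  have phi1: "(phi has_derivative D z) (at z)" if "z \<in> U" for z
    unfolding D_def by (rule Ck_on_Suc_has_derivative[OF U phi that])
  have linD: "linear (D z)" if "z \<in> U" for z
    using has_derivative_linear[OF phi1[OF that]] .
  have a': "(a has_derivative Da z) (at z)" if "z \<in> U" for z
    unfolding a_def Da_def D_def
    by (rule frechet_derivative_field_has_derivative[OF U phi that Ck_on_Suc_has_derivative[OF U g1 that]])
  have linDa: "linear (Da z)" if "z \<in> U" for z
    using has_derivative_linear[OF a'[OF that]] .
  \<comment> \<open>The jet \<open>j\<close> is continued by the constant \<open>p\<close>, which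
    stands for y' or y'' whenever the jet is too short to contain them.\<close>
  define cc where "cc = (\<lambda>(j :: real^2^'r) p k. if k < CARD('r) then j $ from_nat_into UNIV k else p)"
  have cc: "cc j p (to_nat_on UNIV k) = j $ k" for j p k
    by (simp add: cc_def to_nat_on_UNIV_less)
  have fold: "fst (F j) = X j" "snd (F j) $ 1 = V j" "frechet_derivative phi (at z) = D z"
    "D z (g1 z) = a z" for j z
    by (simp_all add: X_def V_def D_def a_def)
  have eqs: "X j \<in> U" "phi (X j) = cc j p 0" "cc j p 1 = V j *\<^sub>R a (X j)"
    "\<exists>b. cc j p 2 = b *\<^sub>R a (X j) + V j *\<^sub>R Da (X j) (driftless g1 g2 (X j) (snd (F j)))"
    if "j \<in> W" for j p
    using flat_jet_equations[where c = "cc j p", OF U phi g1 annih W that free cc]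
    unfolding fold Da_def by this+
  have XU: "X j \<in> U" if "j \<in> W" for j
    using eqs(1)[OF that] .
  have x0U: "x0 \<in> U" using XU[OF j0(1)] X0 by simp

  \<comment> \<open>With y alone in the jet, y' = \<open>p\<close> would be arbitrary and yet equal
    to one vector fixed by \<open>F\<close>.\<close>
  have card: "CARD('r) \<ge> 2"
  proof (rule ccontr)
    assume "\<not> CARD('r) \<ge> 2"
    then have "p = V j0 *\<^sub>R a x0" for p
      using eqs(3)[OF j0(1), of p] by (simp add: cc_def X0)
    from this[of 0] this[of "axis 1 1"] show False by (metis axis_eq_0_iff zero_neq_one)
  qed
  define i :: "nat \<Rightarrow> 'r" where "i = from_nat_into UNIV"
  have to_nat_i: "to_nat_on (UNIV :: 'r set) (i k) = k" if "k < CARD('r)" for k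
    unfolding i_def using that bij_betw_imp_surj_on[OF to_nat_on_finite[of "UNIV :: 'r set"]]
    by (intro to_nat_on_from_nat_into) auto
  have i01: "i 0 \<noteq> i 1" using to_nat_i[of 0] to_nat_i[of 1] card by force
  have out0: "phi (X j) = j $ i 0" if "j \<in> W" for j
    using eqs(2)[OF that] by (simp add: cc_def i_def)
  have out1: "j $ i 1 = V j *\<^sub>R a (X j)" if "j \<in> W" for j
    using eqs(3)[OF that] card by (simp add: cc_def i_def)

  \<comment> \<open>Linearisation of the output identities with respect to the jet\<close>
  define DX where "DX = (\<lambda>j d. fst (frechet_derivative F (at j) d))"
  define DV where "DV = (\<lambda>j d. snd (frechet_derivative F (at j) d) $ 1)"
  have F1: "(F has_derivative frechet_derivative F (at j)) (at j)" if "j \<in> W" for j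
    by (rule Ck_on_Suc_has_derivative[OF W _ that, of 0]) (use F in \<open>simp add: smooth_on_def\<close>)
  have X': "(X has_derivative DX j) (at j)" if "j \<in> W" for j
    unfolding X_def DX_def by (rule has_derivative_fst[OF F1[OF that]])
  have V': "(V has_derivative DV j) (at j)" if "j \<in> W" for j
    unfolding V_def DV_def
    by (rule bounded_linear.has_derivative[OF bounded_linear_vec_nth has_derivative_snd[OF F1[OF that]]])
  have D_DX: "D (X j) (DX j d) = d $ i 0" if j: "j \<in> W" for j d
  proof -
    have "((\<lambda>j. phi (X j)) has_derivative (\<lambda>d. d $ i 0)) (at j)"
      by (rule has_derivative_transform_within_open[OF bounded_linear_imp_has_derivative[OF bounded_linear_vec_nth] W j])
        (rule out0[symmetric])
    from has_derivative_unique[OF has_derivative_compose[OF X'[OF j] phi1[OF XU[OF j]]] this]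
    show ?thesis by (simp add: fun_eq_iff)
  qed
  have Da_DX: "d $ i 1 = DV j d *\<^sub>R a (X j) + V j *\<^sub>R Da (X j) (DX j d)" if j: "j \<in> W" for j d
  proof -
    have "((\<lambda>j. V j *\<^sub>R a (X j)) has_derivative (\<lambda>d. d $ i 1)) (at j)"
      by (rule has_derivative_transform_within_open[OF bounded_linear_imp_has_derivative[OF bounded_linear_vec_nth] W j])
        (rule out1)
    from has_derivative_unique[OF this has_derivative_scaleR[OF V'[OF j]
        has_derivative_compose[OF X'[OF j] a'[OF XU[OF j]]]]]
    show ?thesis by (simp add: fun_eq_iff add.commute)
  qed
  have surj: "surj (D (X j))" if "j \<in> W" for j
    by (rule surjI[of _ "\<lambda>v. DX j (axis (i 0) v)"]) (simp add: D_DX[OF that])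
  then show "surj (frechet_derivative phi (at x0))"
    using j0(1) X0 by (auto simp: D_def)
  \<comment> \<open>With \<open>y\<close> fixed, \<open>y'\<close> can still be varied freely, and the state then moves in the
    one-dimensional kernel of \<open>d\<phi>\<close>.\<close>
  have spanning: "\<exists>b h. D (X j) h = 0 \<and> v = b *\<^sub>R a (X j) + V j *\<^sub>R Da (X j) h" if "j \<in> W" for j v
    using D_DX[OF that, of "axis (i 1) v"] Da_DX[OF that, of "axis (i 1) v"] i01
    by (auto simp: axis_def)

  \<comment> \<open>Hence \<open>x\<close> and \<open>u\<^sup>1\<close> do not react to the derivatives of \<open>y\<close> of order two and higher.\<close>
  have rigid: "DX j d = 0 \<and> DV j d = 0" if j: "j \<in> W" and d: "d $ i 0 = 0" "d $ i 1 = 0" for j d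
  proof -
    have indep: "b = 0 \<and> c = 0"
      if k: "D (X j) k = 0" "k \<noteq> 0" and eq: "b *\<^sub>R a (X j) + c *\<^sub>R (V j *\<^sub>R Da (X j) k) = 0" for k b c
    proof (rule spanning_pair_independent[OF _ eq])
      fix v
      obtain b' h where h: "D (X j) h = 0" and v: "v = b' *\<^sub>R a (X j) + V j *\<^sub>R Da (X j) h"
        using spanning[OF j] by blast
      obtain s where "h = s *\<^sub>R k"
        using kernel_one_dimensional[OF linD[OF XU[OF j]] surj[OF j] k h] by blast
      then have "v = b' *\<^sub>R a (X j) + s *\<^sub>R (V j *\<^sub>R Da (X j) k)"
        by (simp add: v linear_scale[OF linDa[OF XU[OF j]]])
      then show "\<exists>b c. v = b *\<^sub>R a (X j) + c *\<^sub>R (V j *\<^sub>R Da (X j) k)" by blast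
    qed
    have eq: "DV j d *\<^sub>R a (X j) + V j *\<^sub>R Da (X j) (DX j d) = 0" and ker: "D (X j) (DX j d) = 0"
      using D_DX[OF j, of d] Da_DX[OF j, of d] d by simp_all
    \<comment> \<open>Otherwise \<open>DX j d\<close> could serve as the kernel vector
      \<open>k\<close>, and the relation \<open>eq\<close> has coefficient 1 there.\<close>
    have DX0: "DX j d = 0"
      using indep[OF ker, of "DV j d" 1] eq by auto
    moreover have "DV j d = 0"
    proof (rule ccontr)
      assume "DV j d \<noteq> 0"
      then have a0: "a (X j) = 0"
        using eq DX0 by (simp add: linear_0[OF linDa[OF XU[OF j]]])
      obtain b h where "D (X j) h = 0" "axis 1 1 = b *\<^sub>R a (X j) + V j *\<^sub>R Da (X j) h"
        using spanning[OF j] by blast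
      moreover from this have "h \<noteq> 0"
        using a0 by (auto simp: linear_0[OF linDa[OF XU[OF j]]] axis_eq_0_iff)
      ultimately show False using indep[of h 1 0] a0 by simp
    qed
    ultimately show ?thesis ..
  qed

  \<comment> \<open>Nonvanishing of the second field\<close>
  have g2_nonzero: "g2 x0 \<noteq> 0"
  proof
    assume g20: "g2 x0 = 0"
    \<comment> \<open>Then \<open>y'' = (u\<^sup>1)' a + q\<close> where \<open>a\<close> and \<open>q\<close> depend on \<open>y\<close> and \<open>y'\<close> only, although
      \<open>y''\<close> is free.\<close>
    define q where "q = V j0 *\<^sub>R Da x0 (V j0 *\<^sub>R g1 x0)"
    have second: "\<exists>b. cc j p 2 = b *\<^sub>R a x0 + q" if "j \<in> W" "X j = x0" "V j = V j0" for j p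
      using eqs(4)[OF that(1), of p] that(2-3) g20
      by (simp add: q_def driftless_def fold)
    have "\<exists>b. v = b *\<^sub>R a x0" for v
    \<comment> \<open>If the jet ends at y', then \<open>p\<close> prescribes y'' directly;
      otherwise y'' is the jet component \<open>i 2\<close>.\<close>
    proof (cases "CARD('r) = 2")
      case True
      then have "\<exists>b. v + q = b *\<^sub>R a x0 + q"
        using second[OF j0(1) X0 refl, of "v + q"] by (simp add: cc_def)
      then show ?thesis by simp
    next
      case False
      then have card3: "2 < CARD('r)" using card by simp
      have i2: "i 2 \<noteq> i 0" "i 2 \<noteq> i 1"
        using to_nat_i[of 0] to_nat_i[of 1] to_nat_i[of 2] card3 by force+
      have c2: "cc j p 2 = j $ i 2" for j p using card3 by (simp add: cc_def i_def)
      \<comment> \<open>Along this line only y'' changes, so by \<open>rigid\<close> both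
        \<open>X\<close> and \<open>V\<close> stay constant; subtracting the equations at 0 and
        \<open>e/2\<close> isolates \<open>v\<close>.\<close>
      define l where "l = (\<lambda>s. j0 + s *\<^sub>R axis (i 2) v)"
      have "isCont l 0" unfolding l_def by (intro continuous_intros)
      then obtain N where N: "open N" "0 \<in> N" "\<And>t. t \<in> N \<Longrightarrow> l t \<in> W"
        using W j0(1) unfolding continuous_at_open by (metis add.right_neutral l_def scaleR_zero_left)
      then obtain e where e0: "e > 0" "ball 0 e \<subseteq> N"
        using open_contains_ball by metis
      then have lW: "l t \<in> W" if "t \<in> {-e<..<e}" for t
        using N(3) that by (auto simp: subset_iff abs_less_iff)
      have l': "(l has_derivative (\<lambda>s. s *\<^sub>R axis (i 2) v)) (at t)" for t
        unfolding l_def by (auto intro!: derivative_eq_intros)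
      have 0: "DX (l t) (s *\<^sub>R axis (i 2) v) = 0 \<and> DV (l t) (s *\<^sub>R axis (i 2) v) = 0"
        if "t \<in> {-e<..<e}" for t s
        using i2 by (intro rigid lW that) (auto simp: axis_def)
      have "((\<lambda>t. X (l t)) has_derivative (\<lambda>s. 0)) (at t within {-e<..<e})"
        "((\<lambda>t. V (l t)) has_derivative (\<lambda>s. 0)) (at t within {-e<..<e})"
        if t: "t \<in> {-e<..<e}" for t
        using has_derivative_compose[OF l' X'[OF lW[OF t]]] has_derivative_compose[OF l' V'[OF lW[OF t]]] 0[OF t]
        by (simp_all add: has_derivative_at_withinI)
      then have "\<exists>c. \<forall>t\<in>{-e<..<e}. X (l t) = c" "\<exists>c. \<forall>t\<in>{-e<..<e}. V (l t) = c"
        by (intro has_derivative_zero_constant; simp)+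
      moreover have mem: "0 \<in> {-e<..<e}" "e/2 \<in> {-e<..<e}" using e0(1) by auto
      moreover have "l 0 = j0" by (simp add: l_def)
      ultimately have const: "X (l (e/2)) = x0" "V (l (e/2)) = V j0"
        using X0 by metis+
      obtain b where b: "l (e/2) $ i 2 = b *\<^sub>R a x0 + q"
        using second[OF lW[OF mem(2)] const] c2 by metis
      obtain b' where b': "j0 $ i 2 = b' *\<^sub>R a x0 + q"
        using second[OF j0(1) X0 refl] c2 by metis
      have "(e/2) *\<^sub>R v = (b - b') *\<^sub>R a x0"
        using b b' by (simp add: l_def algebra_simps)
      then have "(2 / e) *\<^sub>R ((e/2) *\<^sub>R v) = (2 / e) *\<^sub>R ((b - b') *\<^sub>R a x0)"
        by simp
      then have "v = (2 / e * (b - b')) *\<^sub>R a x0"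
        using e0(1) by simp
      then show ?thesis by blast
    qed
    then show False using not_all_multiples_of_one_vector by blast
  qed

  \<comment> \<open>Differentiating the identity d(phi) \<open>g2\<close> = 0 along
    \<open>g1\<close> trades the derivative of \<open>g2\<close> for a second derivative of
    \<open>phi\<close>, whose symmetry then produces \<open>Da\<close>.\<close>
  have bracket: "D x0 (lie_bracket g1 g2 x0) = - Da x0 (g2 x0)"
  proof -
    have "((\<lambda>z. D z (g2 z)) has_derivative (\<lambda>h. fd2 phi x0 h (g2 x0) +
        D x0 (frechet_derivative g2 (at x0) h))) (at x0)"
      unfolding D_def
      by (rule frechet_derivative_field_has_derivative[OF U phi x0U Ck_on_Suc_has_derivative[OF U g2 x0U]])
    moreover have "((\<lambda>z. D z (g2 z)) has_derivative (\<lambda>h. 0)) (at x0)"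
      by (rule has_derivative_transform_within_open[OF has_derivative_const U x0U])
        (use annih in \<open>simp add: D_def\<close>)
    ultimately have "(\<lambda>h. fd2 phi x0 h (g2 x0) + D x0 (frechet_derivative g2 (at x0) h)) = (\<lambda>h. 0)"
      by (rule has_derivative_unique)
    then have "fd2 phi x0 (g1 x0) (g2 x0) + D x0 (frechet_derivative g2 (at x0) (g1 x0)) = 0"
      by meson
    moreover have "g1 differentiable at x0" "g2 differentiable at x0"
      using Ck_on_Suc_has_derivative[OF U g1 x0U] Ck_on_Suc_has_derivative[OF U g2 x0U]
      by (auto intro: differentiableI)
    ultimately show ?thesis
      using fd2_symmetric[OF U phi x0U, of "g1 x0" "g2 x0"]
      by (simp add: lie_bracket_eq Da_def linear_diff[OF linD[OF x0U]] algebra_simps add_eq_0_iff)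
  qed

  assume mu: "mu \<bullet> g1 x0 = 0" "mu \<bullet> g2 x0 = 0" "mu \<bullet> lie_bracket g1 g2 x0 = 0"
  have "D x0 (g2 x0) = 0" using annih x0U by (simp add: D_def)
  note ker = kernel_one_dimensional[OF linD[OF x0U] surj[OF j0(1), unfolded X0] this g2_nonzero]
  obtain b h where h: "D x0 h = 0" and v: "D x0 mu = b *\<^sub>R a x0 + V j0 *\<^sub>R Da x0 h"
    using spanning[OF j0(1), unfolded X0] by blast
  obtain s where s: "h = s *\<^sub>R g2 x0" using ker[OF h] by blast
  \<comment> \<open>By \<open>bracket\<close>, this combination cancels the image of
    \<open>mu\<close>, so it lies in the line spanned by \<open>g2\<close>.\<close>
  have "D x0 (mu - b *\<^sub>R g1 x0 + (V j0 * s) *\<^sub>R lie_bracket g1 g2 x0) = 0"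
    by (simp add: linear_diff[OF linD[OF x0U]] linear_add[OF linD[OF x0U]] linear_scale[OF linD[OF x0U]]
        bracket v s linear_scale[OF linDa[OF x0U]] a_def)
  from ker[OF this] obtain r where "mu - b *\<^sub>R g1 x0 + (V j0 * s) *\<^sub>R lie_bracket g1 g2 x0 = r *\<^sub>R g2 x0"
    by blast
  then have "mu = b *\<^sub>R g1 x0 - (V j0 * s) *\<^sub>R lie_bracket g1 g2 x0 + r *\<^sub>R g2 x0"
    by (simp add: algebra_simps)
  then have "mu \<bullet> mu = mu \<bullet> (b *\<^sub>R g1 x0 - (V j0 * s) *\<^sub>R lie_bracket g1 g2 x0 + r *\<^sub>R g2 x0)"
    by simp
  also have "\<dots> = 0"
    using mu by (simp add: inner_diff_right inner_add_right)
  finally show "mu = 0" by simp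
qed

section \<open>The singular arc\<close>

lemma spd_inner_commute:
  fixes A :: "real^'n^'n"
  assumes "spd A"
  shows "v \<bullet> (A *v w) = (A *v v) \<bullet> w"
  using assms unfolding spd_def by (metis dot_lmul_matrix transpose_matrix_vector)

lemma spd_matrix_inv:
  fixes A :: "real^'n^'n"
  assumes "spd A"
  shows "matrix_inv A ** A = mat 1" "transpose (matrix_inv A) = matrix_inv A"
proof -
  have "v = 0" if "A *v v = 0" for v
    using assms that unfolding spd_def by (metis inner_zero_right less_irrefl)
  then obtain B where "B ** A = mat 1"
    using matrix_left_invertible_ker[of A] by blast
  then have inv: "invertible A"
    using invertible_left_inverse by blast
  then show l: "matrix_inv A ** A = mat 1" 
    unfolding matrix_inv_def invertible_def by (rule someI2_ex) blast
  have "A ** transpose (matrix_inv A) = mat 1"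
    using arg_cong[OF l, of transpose] assms by (simp add: matrix_transpose_mul spd_def transpose_mat)
  then show "transpose (matrix_inv A) = matrix_inv A"
    by (metis l matrix_mul_assoc matrix_mul_lid matrix_mul_rid)
qed

text \<open>The weight \<open>exp (2 * C * t)\<close> makes the squared norm of \<open>h\<close>
  nondecreasing, so its zero at \<open>b\<close> forces a zero at \<open>a\<close>. The exceptional
  times are absorbed by the fundamental theorem of calculus.\<close>

lemma backward_gronwall_zero:
  fixes h :: "real \<Rightarrow> 'a::real_inner"
  assumes "a \<le> b" "finite S" and cont: "continuous_on {a..b} h"
    and h': "\<And>t. t \<in> {a<..<b} - S \<Longrightarrow> (h has_vector_derivative h' t) (at t)"
    and bound: "\<And>t. t \<in> {a<..<b} - S \<Longrightarrow> norm (h' t) \<le> C * norm (h t)"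
    and "h b = 0"
  shows "h a = 0"
proof -
  define f where "f t = exp (2 * C * t) * (h t \<bullet> h t)" for t
  \<comment> \<open>The value 0 at exceptional times keeps the integrand nonnegative
    everywhere.\<close>
  define f' where "f' t = (if t \<in> {a<..<b} - S then exp (2 * C * t) * (2 * C * (h t \<bullet> h t) + 2 * (h t \<bullet> h' t)) else 0)" for t
  have "(f' has_integral f b - f a) {a..b}"
  proof (rule fundamental_theorem_of_calculus_interior_strong[OF \<open>finite S\<close> \<open>a \<le> b\<close>])
    show "continuous_on {a..b} f"
      unfolding f_def by (intro continuous_intros cont)
    fix t assume t: "t \<in> {a<..<b} - S"
    have "((\<lambda>t. h t \<bullet> h t) has_derivative (\<lambda>r. h t \<bullet> (r *\<^sub>R h' t) + (r *\<^sub>R h' t) \<bullet> h t)) (at t)"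
      using h'[OF t] unfolding has_vector_derivative_def by (intro has_derivative_inner)
    then have "((\<lambda>t. h t \<bullet> h t) has_real_derivative 2 * (h t \<bullet> h' t)) (at t)"
      unfolding has_field_derivative_def by (simp add: inner_commute algebra_simps)
        (simp add: mult_commute_abs)
    then have "(f has_real_derivative exp (2 * C * t) * (2 * C * (h t \<bullet> h t) + 2 * (h t \<bullet> h' t))) (at t)"
      unfolding f_def by (auto intro!: derivative_eq_intros simp: algebra_simps)
    then show "(f has_vector_derivative f' t) (at t)"
      using t by (simp add: f'_def has_real_derivative_iff_has_vector_derivative)
  qed
  moreover have "0 \<le> f' t" for t
  proof (cases "t \<in> {a<..<b} - S")
    case True
    have "- (h t \<bullet> h' t) \<le> norm (h t) * norm (h' t)"
      using Cauchy_Schwarz_ineq2[of "h t" "h' t"] by linarith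
    also have "\<dots> \<le> norm (h t) * (C * norm (h t))"
      by (intro mult_left_mono bound[OF True]) simp
    also have "\<dots> = C * (h t \<bullet> h t)"
      by (simp add: dot_square_norm power2_eq_square)
    finally show ?thesis using True by (simp add: f'_def)
  next
    case False
    show ?thesis unfolding f'_def if_not_P[OF False] by simp
  qed
  ultimately have "0 \<le> f b - f a"
    by (rule has_integral_nonneg)
  moreover have "f b = 0" by (simp add: f_def \<open>h b = 0\<close>)
  ultimately have "exp (2 * C * a) * (h a \<bullet> h a) \<le> 0" by (simp add: f_def)
  then have "h a \<bullet> h a \<le> 0" by (simp add: mult_le_0_iff)
  then show ?thesis by (metis inner_ge_zero inner_eq_zero_iff order_antisym)
qed

text \<open>Here \<open>f\<close> is the integral of the continuous \<open>f'\<close>, so the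
  derivative formula extends across the exceptional times and, one-sidedly, to the end
  points.\<close>

lemma has_vector_derivative_removable:
  fixes f :: "real \<Rightarrow> 'a::banach"
  assumes "finite S" and f: "continuous_on {a..b} f" and f': "continuous_on {a..b} f'"
    and deriv: "\<And>t. t \<in> {a<..<b} - S \<Longrightarrow> (f has_vector_derivative f' t) (at t)"
    and t: "t \<in> {a..b}"
  shows "(f has_vector_derivative f' t) (at t within {a..b})"
proof -
  have eq: "f a + integral {a..r} f' = f r" if r: "r \<in> {a..b}" for r
  proof -
    have "(f' has_integral f r - f a) {a..r}"
      using r by (intro fundamental_theorem_of_calculus_interior_strong[OF \<open>finite S\<close>]
          continuous_on_subset[OF f] deriv) auto
    then show ?thesis by (simp add: integral_unique)
  qed
  have "((\<lambda>r. f a + integral {a..r} f') has_vector_derivative 0 + f' t) (at t within {a..b})"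
    by (intro has_vector_derivative_add has_vector_derivative_const integral_has_vector_derivative f' t)
  then have "((\<lambda>r. f a + integral {a..r} f') has_vector_derivative f' t) (at t within {a..b})"
    by simp
  then show ?thesis
    by (rule has_vector_derivative_transform[OF t, rotated]) (simp add: eq)
qed

text \<open>On the singular arc the costate is the covector \<open>e' M d\<phi>\<close>; the hypothesis \<open>lam\<close> says so.\<close>
lemma costate_rhs_eq:
  fixes phi :: "real^3 \<Rightarrow> real^2"
  assumes U: "open U" and phi: "Ck_on (Suc (Suc 0)) phi U"
    and g1: "Ck_on (Suc 0) g1 U" and g2: "Ck_on (Suc 0) g2 U"
    and annih: "\<forall>z\<in>U. frechet_derivative phi (at z) (g2 z) = 0"
    and xU: "x t \<in> U" and Q: "\<And>v w. v \<bullet> (Q *v w) = (Q *v v) \<bullet> w" and M: "\<And>v w. v \<bullet> (M *v w) = (M *v v) \<bullet> w"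
    and lam: "\<And>h. lam t \<bullet> h = (M *v err_dot T yd g1 phi x u t) \<bullet> frechet_derivative phi (at (x t)) h"
  shows "costate_rhs T yd g1 g2 phi Q M x u lam t $ k =
    (Q *v err yd phi x t) \<bullet> frechet_derivative phi (at (x t)) (axis k 1) +
    (M *v err_dot T yd g1 phi x u t) \<bullet> fd2 phi (x t) (driftless g1 g2 (x t) (u t)) (axis k 1)"
proof -
  let ?z = "x t" and ?v = "axis k 1 :: real^3"
  let ?D = "\<lambda>z. frechet_derivative phi (at z)"
  have diff: "f differentiable at z" if "Ck_on (Suc 0) f U" "z \<in> U" for f :: "real^3 \<Rightarrow> real^3" and z
    using Ck_on_Suc_has_derivative[OF U that] by (rule differentiableI)
  have dphi: "phi differentiable at z" if "z \<in> U" for z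
    using Ck_on_Suc_has_derivative[OF U phi that] by (rule differentiableI)
  have a: "(lie_deriv_vec g1 phi has_derivative (\<lambda>h. fd2 phi ?z h (g1 ?z) +
      ?D ?z (frechet_derivative g1 (at ?z) h))) (at ?z)"
    by (rule has_derivative_transform_within_open[OF frechet_derivative_field_has_derivative[OF U phi xU
            Ck_on_Suc_has_derivative[OF U g1 xU]] U xU])
      (simp add: lie_deriv_vec_eq dphi)
  then have pa: "partial_vec k (lie_deriv_vec g1 phi) ?z = fd2 phi ?z ?v (g1 ?z) + ?D ?z (frechet_derivative g1 (at ?z) ?v)"
    by (simp add: partial_vec_eq[OF differentiableI[OF a]] flip: frechet_derivative_at[OF a])
  have "((\<lambda>z. ?D z (g2 z)) has_derivative (\<lambda>h. 0)) (at ?z)"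
    by (rule has_derivative_transform_within_open[OF has_derivative_const U xU]) (use annih in simp)
  from has_derivative_unique[OF this frechet_derivative_field_has_derivative[OF U phi xU
        Ck_on_Suc_has_derivative[OF U g2 xU]]]
  have "fd2 phi ?z ?v (g2 ?z) + ?D ?z (frechet_derivative g2 (at ?z) ?v) = 0"
    by (simp add: fun_eq_iff)
  then have b: "?D ?z (frechet_derivative g2 (at ?z) ?v) = - fd2 phi ?z ?v (g2 ?z)"
    by (simp add: add_eq_0_iff)
  note lin = fd2_linear_right[OF U phi xU]
  \<comment> \<open>The terms with derivatives of \<open>g1\<close> cancel between the running cost
    and \<open>lam\<close>; those with derivatives of \<open>g2\<close> turn by \<open>b\<close>
    into second derivatives of \<open>phi\<close>.\<close>
  show ?thesis
    unfolding costate_rhs_def driftless_def fd2_symmetric[OF U phi xU, of _ ?v]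
    by (simp add: Q M lam pa partial_vec_eq[OF diff[OF g1 xU]] partial_vec_eq[OF diff[OF g2 xU]]
        partial_vec_eq[OF dphi[OF xU]] b linear_add[OF lin] linear_scale[OF lin]
        inner_add_right algebra_simps)
qed

text \<open>Surjectivity makes the adjoint injective, so \<open>G\<close> is positive on the compact
  product of the interval with the unit sphere. Its minimum serves as \<open>K\<close>; homogeneity
  covers the other vectors.\<close>

lemma adjoint_lower_bound:
  fixes f :: "'a::euclidean_space \<Rightarrow> 'b::euclidean_space" and x :: "real \<Rightarrow> 'a"
  assumes "open U" "Ck_on (Suc k) f U" and x: "continuous_on {a..b} x" "x ` {a..b} \<subseteq> U"
    and surj: "\<And>t. t \<in> {a..b} \<Longrightarrow> surj (frechet_derivative f (at (x t)))"
  shows "\<exists>K>0. \<forall>t\<in>{a..b}. \<forall>v. K * norm v \<le> (\<Sum>i\<in>Basis. \<bar>v \<bullet> frechet_derivative f (at (x t)) i\<bar>)"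
proof (cases "a \<le> b")
  case True
  define G where "G p = (\<Sum>i\<in>Basis. \<bar>snd p \<bullet> frechet_derivative f (at (x (fst p))) i\<bar>)" for p :: "real \<times> 'b"
  let ?C = "{a..b} \<times> sphere (0::'b) 1"
  have "continuous_on ?C G"
    unfolding G_def using assms(2) x
    by (intro continuous_intros frechet_derivative_continuous_on[OF assms(1,2)]
        continuous_on_compose2[OF x(1) continuous_on_fst]) auto
  moreover have "compact ?C" by (intro compact_Times compact_Icc compact_sphere)
  moreover obtain i :: 'b where "i \<in> Basis" using nonempty_Basis by blast
  then have "(a, i) \<in> ?C" using True by simp
  ultimately obtain p where p: "p \<in> ?C" "\<And>q. q \<in> ?C \<Longrightarrow> G p \<le> G q"
    using continuous_attains_inf[of ?C G] by blast
  obtain t v where tv: "p = (t, v)" "t \<in> {a..b}" "norm v = 1" using p(1) by auto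
  have "G p > 0"
  proof (rule ccontr)
    assume "\<not> G p > 0"
    moreover have "G p \<ge> 0" unfolding G_def by (intro sum_nonneg) simp
    ultimately have "G p = 0" by simp
    then have 0: "v \<bullet> frechet_derivative f (at (x t)) i = 0" if "i \<in> Basis" for i
      using that by (simp add: G_def tv sum_nonneg_eq_0_iff)
    obtain h where h: "frechet_derivative f (at (x t)) h = v"
      using surj[OF tv(2)] by (metis surjD)
    have "f differentiable at (x t)"
      using Ck_on_Suc_has_derivative[OF assms(1,2)] x(2) tv(2) by (blast intro: differentiableI)
    then have "v = (\<Sum>b\<in>Basis. (h \<bullet> b) *\<^sub>R frechet_derivative f (at (x t)) b)"
      using frechet_derivative_Basis_expand h by metis
    then have "v \<bullet> v = v \<bullet> (\<Sum>b\<in>Basis. (h \<bullet> b) *\<^sub>R frechet_derivative f (at (x t)) b)"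
      by simp
    also have "\<dots> = 0" by (simp add: inner_sum_right 0)
    finally show False using tv(3) by simp
  qed
  moreover have "G p * norm v \<le> G (t, v)" if "t \<in> {a..b}" for t v
  proof (cases "v = 0")
    case False
    have "(t, (1 / norm v) *\<^sub>R v) \<in> ?C" using that False by simp
    from p(2)[OF this] have "G p \<le> (1 / norm v) * G (t, v)"
      by (simp add: G_def sum_distrib_left abs_mult)
    then show ?thesis using False by (simp add: field_simps)
  qed (simp add: G_def)
  ultimately show ?thesis unfolding G_def by (metis fst_conv snd_conv)
qed (auto intro: exI[of _ 1])

theorem mainTheorem3:
  fixes U :: "(real^3) set"
    and g1 g2 :: "real^3 \<Rightarrow> real^3"
    and phi :: "real^3 \<Rightarrow> real^2"
    and x0 :: "real^3" and umax :: "real^2" and T :: real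
    and yd :: "real \<Rightarrow> real^2"
    and Qbar Q M :: "real^2^2"
    and x :: "real \<Rightarrow> real^3" and u :: "real \<Rightarrow> real^2" and lam :: "real \<Rightarrow> real^3"
    and I :: "real set"
  assumes "open U" and "smooth_on U g1" and "smooth_on U g2"
    and "x_flat_output TYPE('r::finite) U g1 g2 phi"
    and "\<forall>z\<in>U. \<forall>i. lie_deriv g2 (\<lambda>y. phi y $ i) z = 0"
    and "0 < T" and "smooth_on_interval 0 T yd"
    and "spd Qbar" and "spd Q" and "spd M"
    and "\<forall>i j. Q $ i $ j = (\<Sum>l\<in>UNIV. \<Sum>m\<in>UNIV. Qbar $ i $ l * matrix_inv M $ l $ m * Qbar $ m $ j)"
    and "optimal U g1 g2 phi x0 umax T yd Qbar Q M x u"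
    and "costate T yd g1 g2 phi Qbar Q M x u lam"
    and "singular_arc T yd g1 g2 phi M x u lam I"
    and "T \<in> closure I"
  shows "\<forall>t\<in>I.
     (err yd phi x has_vector_derivative error_matrix Qbar M *v err yd phi x t) (at t within I) \<and>
     err_dot T yd g1 phi x u t = error_matrix Qbar M *v err yd phi x t"
proof -
  note U = assms(1)
  have g1: "Ck_on (Suc 0) g1 U" and g2: "Ck_on (Suc 0) g2 U" and phi: "Ck_on (Suc (Suc 0)) phi U"
    using assms(2,3,4) by (simp_all only: smooth_on_def x_flat_output_def)
  have phi': "(phi has_derivative frechet_derivative phi (at z)) (at z)" if "z \<in> U" for z
    using Ck_on_Suc_has_derivative[OF U phi that] .
  have phid: "phi differentiable at z" if "z \<in> U" for z
    using phi'[OF that] by (rule differentiableI)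
  have annih: "\<forall>z\<in>U. frechet_derivative phi (at z) (g2 z) = 0"
    using assms(5) by (simp add: phid vec_eq_iff lie_deriv_vec_def flip: lie_deriv_vec_eq)
  have adm: "continuous_on {0..T} x" "\<And>t. t \<in> {0..T} \<Longrightarrow> x t \<in> U"
    and umax: "\<And>t a. t \<in> {0..T} \<Longrightarrow> \<bar>u t $ a\<bar> \<le> umax $ a"
    using assms(12) by (auto simp: optimal_def admissible_def)
  have xU: "x ` {0..T} \<subseteq> U" using adm(2) by blast
  have "\<exists>S. finite S \<and> (\<forall>t\<in>{0..T} - S.
          (x has_vector_derivative driftless g1 g2 (x t) (u t)) (at t within {0..T}))"
    using assms(12) unfolding optimal_def admissible_def by blast
  then obtain S1 where S1: "finite S1" "\<And>t. t \<in> {0..T} - S1 \<Longrightarrow>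
      (x has_vector_derivative driftless g1 g2 (x t) (u t)) (at t within {0..T})"
    by blast
  obtain S2 where S2: "finite S2" "\<And>t. t \<in> {0..T} - S2 \<Longrightarrow>
      (lam has_vector_derivative costate_rhs T yd g1 g2 phi Q M x u lam t) (at t within {0..T})"
    using assms(13) unfolding costate_def by blast
  have lam: "continuous_on {0..T} lam"
    "lam T = (\<chi> k. - (err yd phi x T \<bullet> (Qbar *v partial_vec k phi (x T))))"
    using assms(13) by (auto simp: costate_def)
  define S where "S = S1 \<union> S2"
  have S: "finite S" by (simp add: S_def S1 S2)
  have I: "is_interval I" "I \<subseteq> {0..T}"
    using assms(14) by (auto simp: singular_arc_def)

  \<comment> \<open>The costate as a pullback by the differential of the output\<close>
  define e where "e = err yd phi x"
  define w where "w = (\<lambda>t. M *v err_dot T yd g1 phi x u t)"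
  define D where "D = (\<lambda>t. frechet_derivative phi (at (x t)))"
  define s where "s = (\<lambda>t. w t + Qbar *v e t)"
  note spdc = assms(8-10)[THEN spd_inner_commute]
  have linD: "linear (D t)" if "t \<in> {0..T}" for t
    unfolding D_def using has_derivative_linear[OF phi'] adm(2) that by blast
  have flat: "x_flat_output_at TYPE('r) U g1 g2 phi (x t)" if "t \<in> {0..T}" for t
    using assms(4) adm(2)[OF that] by (simp add: x_flat_output_def)
  note regular = x_flat_output_at_regular[OF U phi g1 g2 annih flat]

  \<comment> \<open>The three conditions of the singular arc say that \<open>lam - e' M d\<phi>\<close> annihilates \<open>g1\<close>, \<open>g2\<close>
    and \<open>[g1,g2]\<close>.\<close>
  have lamI: "lam t \<bullet> h = w t \<bullet> D t h" if t: "t \<in> I" for t h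
  proof -
    have t': "t \<in> {0..T}" using t I by blast
    define mu where "mu = lam t - adjoint (D t) (w t)"
    have mu: "mu \<bullet> h = lam t \<bullet> h - w t \<bullet> D t h" for h
      using adjoint_works[OF linD[OF t'], of h "w t"]
      by (simp add: mu_def inner_diff_right inner_commute)
    have "xi1 T yd g1 phi M x u lam t = 0" "xi2 g2 x lam t = 0" "xi2_dot_bracket T yd g1 g2 phi M x u lam t = 0"
      using assms(14) t by (auto simp: singular_arc_def)
    then have "mu \<bullet> g1 (x t) = 0" "mu \<bullet> g2 (x t) = 0" "mu \<bullet> lie_bracket g1 g2 (x t) = 0"
      using annih adm(2)[OF t']
      by (simp_all add: mu w_def D_def xi1_def xi2_def xi2_dot_bracket_def spdc lie_deriv_vec_eq phid)
    from regular(2)[OF t' this] have "mu \<bullet> h = 0" by simp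
    then show ?thesis using mu by simp
  qed

  have w_inv: "err_dot T yd g1 phi x u t = matrix_inv M *v w t" for t
    by (simp add: w_def matrix_vector_mul_assoc spd_matrix_inv(1)[OF assms(10)])
  define N where "N = Qbar ** matrix_inv M"
  have "Q $ i $ j = (N ** Qbar) $ i $ j" for i j
    using assms(11) by (simp add: N_def matrix_matrix_mult_def sum_distrib_right) (rule sum.swap)
  then have Q: "Q = N ** Qbar" by (simp add: vec_eq_iff)
  \<comment> \<open>The special form of \<open>Q\<close> enters here: it lets \<open>N\<close> be
    factored out, leaving exactly \<open>s\<close>.\<close>
  have Ns: "Q *v e t + Qbar *v err_dot T yd g1 phi x u t = N *v s t" for t
    by (simp add: Q N_def s_def w_inv matrix_vector_right_distrib matrix_vector_mul_assoc add.commute)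

  \<comment> \<open>Regularity of the tracking error\<close>
  have e_cont: "continuous_on {0..T} e"
  proof -
    obtain Y :: "nat \<Rightarrow> real \<Rightarrow> real^2" where Y: "\<forall>t\<in>{0..T}. Y 0 t = yd t"
      "\<forall>k. \<forall>t\<in>{0..T}. (Y k has_vector_derivative Y (Suc k) t) (at t within {0..T})"
      using assms(7) unfolding smooth_on_interval_def by blast
    have "continuous_on {0..T} (Y 0)"
      unfolding continuous_on_eq_continuous_within
      using Y(2) has_vector_derivative_continuous by blast
    then have "continuous_on {0..T} yd" by (rule continuous_on_eq) (use Y in auto)
    moreover have "continuous_on U phi"
      by (rule differentiable_imp_continuous_on) (use phi in simp)
    ultimately show ?thesis
      unfolding e_def err_def[abs_def]
      by (intro continuous_on_diff continuous_on_compose2[OF _ adm(1) xU])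
  qed
  have interior: "at t within {0..T} = at t" if "t \<in> {0<..<T}" for t
    using that by (simp add: at_within_Icc_at)
  have e_deriv: "(e has_vector_derivative err_dot T yd g1 phi x u t) (at t)"
    if t: "t \<in> {0<..<T} - S" for t
  proof -
    have t': "t \<in> {0..T}" using t by auto
    obtain Y :: "nat \<Rightarrow> real \<Rightarrow> real^2" where Y: "\<forall>t\<in>{0..T}. Y 0 t = yd t"
      "\<forall>k. \<forall>t\<in>{0..T}. (Y k has_vector_derivative Y (Suc k) t) (at t within {0..T})"
      using assms(7) unfolding smooth_on_interval_def by blast
    have "(yd has_vector_derivative Y 1 t) (at t within {0..T})"
      by (rule has_vector_derivative_transform[OF t', of _ "Y 0"]) (use Y t' in auto)
    then have yd': "(yd has_vector_derivative vector_derivative yd (at t within {0..T})) (at t within {0..T})"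
      using differentiableI_vector vector_derivative_works by blast
    have "((phi \<circ> x) has_vector_derivative D t (driftless g1 g2 (x t) (u t))) (at t within {0..T})"
      unfolding D_def
      by (rule vector_derivative_diff_chain_within[OF S1(2) has_derivative_at_withinI[OF phi'[OF adm(2)[OF t']]]])
        (use t t' in \<open>auto simp: S_def\<close>)
    from has_vector_derivative_diff[OF yd' this]
    have "(e has_vector_derivative vector_derivative yd (at t within {0..T}) -
        D t (driftless g1 g2 (x t) (u t))) (at t within {0..T})"
      by (simp add: e_def err_def[abs_def] o_def)
    moreover have "D t (driftless g1 g2 (x t) (u t)) = u t $ 1 *\<^sub>R lie_deriv_vec g1 phi (x t)"
      unfolding driftless_def linear_add[OF linD[OF t']] linear_scale[OF linD[OF t']]
      using annih adm(2)[OF t'] by (simp add: D_def lie_deriv_vec_eq phid)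
    ultimately show ?thesis using t by (simp add: err_dot_def interior)
  qed

  \<comment> \<open>Pulling \<open>s\<close> back by \<open>d\<phi>\<close> gives \<open>eta\<close> on the arc. Unlike \<open>w\<close>, it is differentiable without
    further argument, and it vanishes at \<open>T\<close> even if \<open>T\<close> is not in the arc.\<close>
  define b where "b k = (axis k 1 :: real^3)" for k
  define eta where "eta t = (\<chi> k. lam t $ k + (Qbar *v e t) \<bullet> D t (b k))" for t
  define eta' where "eta' t = (\<chi> k. (N *v s t) \<bullet> D t (b k) + s t \<bullet> fd2 phi (x t) (driftless g1 g2 (x t) (u t)) (b k))" for t
  have D_cont: "continuous_on {0..T} (\<lambda>t. D t v)" for v
    unfolding D_def by (intro frechet_derivative_continuous_on[OF U phi] adm(1) xU continuous_intros)
  have eta_cont: "continuous_on {0..T} eta"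
    unfolding eta_def by (intro continuous_intros lam(1) e_cont D_cont
        linear_continuous_on_compose[OF e_cont] matrix_vector_mul_linear)
  have eta_s: "eta t $ k = s t \<bullet> D t (b k)" if "t \<in> I" for t k
  proof -
    have "lam t $ k = lam t \<bullet> b k" by (simp add: b_def inner_axis)
    then show ?thesis using lamI[OF that] by (simp add: eta_def s_def inner_add_left)
  qed
  have eta_deriv: "(eta has_vector_derivative eta' t) (at t)" if t: "t \<in> I" "t \<in> {0<..<T} - S" for t
  proof -
    have t': "t \<in> {0..T}" using t(2) by auto
    let ?r = "costate_rhs T yd g1 g2 phi Q M x u lam t" and ?x' = "driftless g1 g2 (x t) (u t)"
    have lam': "(lam has_vector_derivative ?r) (at t)"
      using S2(2)[of t] t t' by (simp add: S_def interior)
    have x': "(x has_vector_derivative ?x') (at t)"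
      using S1(2)[of t] t t' by (simp add: S_def interior)
    have "((\<lambda>t. lam t $ k + (Qbar *v e t) \<bullet> D t (b k)) has_vector_derivative eta' t $ k) (at t)" for k
    proof -
      have 1: "((\<lambda>t. lam t $ k) has_vector_derivative ?r $ k) (at t)"
        by (rule bounded_linear.has_vector_derivative[OF bounded_linear_vec_nth lam'])
      have 2: "((\<lambda>t. Qbar *v e t) has_vector_derivative Qbar *v err_dot T yd g1 phi x u t) (at t)"
        by (rule bounded_linear.has_vector_derivative[OF matrix_vector_mul_bounded_linear e_deriv[OF t(2)]])
      have 3: "((\<lambda>t. D t (b k)) has_vector_derivative fd2 phi (x t) ?x' (b k)) (at t)"
        using vector_derivative_diff_chain_within[OF x' has_derivative_at_withinI[OF fd2_has_derivative[OF U phi adm(2)[OF t']]]]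
        by (simp add: D_def o_def)
      have "?r $ k = (Q *v e t) \<bullet> D t (b k) + w t \<bullet> fd2 phi (x t) ?x' (b k)"
        unfolding e_def w_def D_def b_def
        by (rule costate_rhs_eq[where x = x and t = t, OF U phi g1 g2 annih adm(2)[OF t'] spdc(2,3)])
          (rule lamI[OF t(1), unfolded w_def D_def])
      then have eq: "eta' t $ k = ?r $ k + ((Qbar *v e t) \<bullet> fd2 phi (x t) ?x' (b k) +
          (Qbar *v err_dot T yd g1 phi x u t) \<bullet> D t (b k))"
        by (simp add: eta'_def Ns[symmetric] inner_add_left) (simp add: s_def inner_add_left)
      show ?thesis
        unfolding eq
        by (intro has_vector_derivative_add 1 bounded_bilinear.has_vector_derivative[OF bounded_bilinear_inner] 2 3)
    qed
    then show ?thesis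
      unfolding eta_def has_vector_derivative_def
      by (subst has_derivative_componentwise_within) (auto simp: Basis_vec_def inner_axis)
  qed

  \<comment> \<open>Growth estimates for the pulled-back quantity\<close>
  obtain K where K: "K > 0" "\<And>t v. t \<in> {0..T} \<Longrightarrow> K * norm v \<le> (\<Sum>i\<in>Basis. \<bar>v \<bullet> D t i\<bar>)"
    using adjoint_lower_bound[OF U phi adm(1) xU regular(1)] unfolding D_def by blast
  \<comment> \<open>The factor 3 counts the coordinate directions of the state space.\<close>
  have s_le: "K * norm (s t) \<le> 3 * norm (eta t)" if t: "t \<in> I" for t
  proof -
    have "K * norm (s t) \<le> (\<Sum>i\<in>Basis. \<bar>s t \<bullet> D t i\<bar>)"
      using K(2) t I by blast
    also have "\<dots> \<le> (\<Sum>i\<in>(Basis :: (real^3) set). norm (eta t))"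
    proof (rule sum_mono)
      fix i :: "real^3" assume "i \<in> Basis"
      then obtain k where "i = b k" by (auto simp: Basis_vec_def b_def)
      then show "\<bar>s t \<bullet> D t i\<bar> \<le> norm (eta t)"
        using component_le_norm_cart[of "eta t" k] eta_s[OF t] by simp
    qed
    finally show ?thesis by simp
  qed

  \<comment> \<open>The possibly discontinuous inputs are replaced by their bounds
    \<open>umax\<close>, which makes \<open>beta\<close> continuous and hence bounded on the compact
    interval.\<close>
  define beta where "beta t = (\<Sum>k\<in>UNIV. onorm ((*v) N) * norm (D t (b k)) +
      (umax $ 1 * norm (fd2 phi (x t) (g1 (x t)) (b k)) + umax $ 2 * norm (fd2 phi (x t) (g2 (x t)) (b k))))" for t
  have gc: "continuous_on {0..T} (\<lambda>t. g (x t))" if "Ck_on (Suc 0) g U" for g :: "real^3 \<Rightarrow> real^3"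
    using that by (intro continuous_on_compose2[OF differentiable_imp_continuous_on adm(1) xU]) simp
  have "continuous_on {0..T} beta"
    unfolding beta_def
    by (intro continuous_intros D_cont fd2_continuous_on[OF U phi] adm(1) xU gc g1 g2)
  then have "bounded (beta ` {0..T})"
    by (intro compact_imp_bounded compact_continuous_image compact_Icc)
  then obtain B where B: "\<And>t. t \<in> {0..T} \<Longrightarrow> beta t \<le> B"
    unfolding bounded_iff by (metis image_eqI real_norm_def abs_le_D1)
  have eta'_le: "norm (eta' t) \<le> B * norm (s t)" if t: "t \<in> {0..T}" for t
  proof -
    note lin = fd2_linear_left[OF U phi adm(2)[OF t]]
    have "\<bar>eta' t $ k\<bar> \<le> (onorm ((*v) N) * norm (D t (b k)) +
      (umax $ 1 * norm (fd2 phi (x t) (g1 (x t)) (b k)) + umax $ 2 * norm (fd2 phi (x t) (g2 (x t)) (b k)))) * norm (s t)" for k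
    proof -
      have "\<bar>(N *v s t) \<bullet> D t (b k)\<bar> \<le> norm (N *v s t) * norm (D t (b k))"
        by (rule Cauchy_Schwarz_ineq2)
      also have "\<dots> \<le> onorm ((*v) N) * norm (s t) * norm (D t (b k))"
        by (intro mult_right_mono onorm matrix_vector_mul_bounded_linear norm_ge_zero)
      finally have 1: "\<bar>(N *v s t) \<bullet> D t (b k)\<bar> \<le> onorm ((*v) N) * norm (D t (b k)) * norm (s t)"
        by (simp add: mult_ac)
      let ?R = "umax $ 1 * norm (fd2 phi (x t) (g1 (x t)) (b k)) + umax $ 2 * norm (fd2 phi (x t) (g2 (x t)) (b k))"
      have "norm (fd2 phi (x t) (driftless g1 g2 (x t) (u t)) (b k))
          \<le> \<bar>u t $ 1\<bar> * norm (fd2 phi (x t) (g1 (x t)) (b k)) + \<bar>u t $ 2\<bar> * norm (fd2 phi (x t) (g2 (x t)) (b k))"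
        unfolding driftless_def linear_add[OF lin] linear_scale[OF lin]
        by (intro norm_triangle_le) simp
      also have "\<dots> \<le> ?R"
        by (intro add_mono mult_right_mono umax t norm_ge_zero)
      finally have R: "norm (fd2 phi (x t) (driftless g1 g2 (x t) (u t)) (b k)) \<le> ?R" .
      have "\<bar>s t \<bullet> fd2 phi (x t) (driftless g1 g2 (x t) (u t)) (b k)\<bar>
          \<le> norm (s t) * norm (fd2 phi (x t) (driftless g1 g2 (x t) (u t)) (b k))"
        by (rule Cauchy_Schwarz_ineq2)
      also have "\<dots> \<le> norm (s t) * ?R"
        by (intro mult_left_mono R norm_ge_zero)
      finally have 2: "\<bar>s t \<bullet> fd2 phi (x t) (driftless g1 g2 (x t) (u t)) (b k)\<bar> \<le> ?R * norm (s t)"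
        by (simp only: mult.commute)
      show ?thesis
        using add_mono[OF 1 2] abs_triangle_ineq order_trans
        unfolding eta'_def vec_lambda_beta distrib_right[of "onorm _ * _"] by blast
    qed
    then have "(\<Sum>k\<in>UNIV. \<bar>eta' t $ k\<bar>) \<le> beta t * norm (s t)"
      unfolding beta_def sum_distrib_right by (rule sum_mono)
    also have "\<dots> \<le> B * norm (s t)"
      by (intro mult_right_mono B t norm_ge_zero)
    finally show ?thesis using norm_le_l1_cart[of "eta' t"] by linarith
  qed

  \<comment> \<open>The transversality condition: \<open>lam\<close> at \<open>T\<close> is minus
    the pullback of \<open>Qbar\<close> applied to the error.\<close>
  have "eta T = 0"
    using adm(2)[of T] assms(6) 
    by (simp add: eta_def lam(2) vec_eq_iff e_def D_def b_def partial_vec_eq phid spdc(1))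
  \<comment> \<open>As an interval whose closure contains \<open>T\<close>, the arc fills everything
    from \<open>t\<close> up to \<open>T\<close>, where the estimate has to run.\<close>
  have between: "r \<in> I" if t: "t \<in> I" and r: "t \<le> r" "r < T" for t r
  proof -
    obtain t' where "t' \<in> I" "dist t' T < T - r"
      using assms(15) r by (meson closure_approachable diff_gt_0_iff_gt)
    then have "t' \<in> I" "r \<le> t'" by (auto simp: dist_real_def)
    then show ?thesis using I(1) t r(1) by (meson mem_is_interval_1_I)
  qed
  have "eta t = 0" if t: "t \<in> I" for t
  proof (rule backward_gronwall_zero[where h = eta and b = T])
    show "finite S" "eta T = 0" by fact+
    show "t \<le> T" and "continuous_on {t..T} eta"
      using I(2) t by (auto intro!: continuous_on_subset[OF eta_cont])
    fix r assume r: "r \<in> {t<..<T} - S"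
    then have rI: "r \<in> I" "r \<in> {0<..<T} - S" using between[OF t, of r] I t by auto
    show "(eta has_vector_derivative eta' r) (at r)" by (rule eta_deriv[OF rI])
    have r': "r \<in> {0..T}" using rI(2) by auto
    \<comment> \<open>The sign of \<open>B\<close> is not recorded, hence the absolute
      value.\<close>
    have "B * norm (s r) \<le> \<bar>B\<bar> * norm (s r)" by (intro mult_right_mono) auto
    also have "\<dots> \<le> \<bar>B\<bar> * (3 / K * norm (eta r))"
      using s_le[OF rI(1)] K(1) by (intro mult_left_mono) (auto simp: field_simps)
    finally show "norm (eta' r) \<le> (\<bar>B\<bar> * (3 / K)) * norm (eta r)"
      using eta'_le[OF r'] by simp
  qed
  then have "s t = 0" if "t \<in> I" for t
    using s_le[OF that] that K(1) by (simp add: mult_le_0_iff)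
  then have w: "w t = - (Qbar *v e t)" if "t \<in> I" for t
    using that by (simp add: s_def eq_neg_iff_add_eq_0)
  \<comment> \<open>The row of \<open>error_matrix\<close> is the index of the differentiated error
    component, so the matrix is -\<open>N\<close> transposed, that is, -\<open>M\<close>^-1
    \<open>Qbar\<close>.\<close>
  have "transpose N = matrix_inv M ** Qbar"
    using assms(8) by (simp add: N_def matrix_transpose_mul spd_matrix_inv(2)[OF assms(10)] spd_def)
  moreover have "error_matrix Qbar M = - transpose N"
    by (simp add: error_matrix_def N_def vec_eq_iff transpose_def matrix_matrix_mult_def)
  moreover have "(- A) *v v = - (A *v v)" for A :: "real^2^2" and v
    by (simp add: matrix_vector_mult_def vec_eq_iff sum_negf)
  ultimately have E: "error_matrix Qbar M *v v = - (matrix_inv M *v (Qbar *v v))" for v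
    by (simp add: matrix_vector_mul_assoc)
  have err_dot: "err_dot T yd g1 phi x u t = error_matrix Qbar M *v e t" if "t \<in> I" for t
    using linear_neg[OF matrix_vector_mul_linear] by (simp add: E w_inv w[OF that])

  \<comment> \<open>The derivative of the error relative to the arc\<close>
  define c where "c = Inf I"
  have bdd: "bdd_below I" using I(2) by (meson bdd_below.I atLeastAtMost_iff subsetD)
  have Ic: "I \<subseteq> {c..T}" using I(2) cInf_lower[OF _ bdd] by (auto simp: c_def)
  have cI: "r \<in> I" if r: "r \<in> {c<..<T}" for r
  proof -
    have "I \<noteq> {}" using assms(14) by (auto simp: singular_arc_def)
    then obtain t where "t \<in> I" "t < r" using r cInf_less_iff[OF _ bdd] by (auto simp: c_def)
    then show ?thesis using between[of t r] r by simp
  qed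
  have c0: "0 \<le> c" using I(2) assms(14) by (auto simp: c_def singular_arc_def intro!: cInf_greatest)
  have "(e has_vector_derivative error_matrix Qbar M *v e t) (at t within I)" if t: "t \<in> I" for t
  \<comment> \<open>The arc may miss its end points, so the closed hull is used first. On its
    interior the error derivative is given by a continuous function of the error, which makes the
    exceptional times removable.\<close>
  proof (rule has_vector_derivative_within_subset[OF _ Ic])
    have sub: "{c..T} \<subseteq> {0..T}" using c0 by auto
    show "(e has_vector_derivative error_matrix Qbar M *v e t) (at t within {c..T})"
    proof (rule has_vector_derivative_removable[OF S])
      show "continuous_on {c..T} e" "continuous_on {c..T} (\<lambda>t. error_matrix Qbar M *v e t)"
        using continuous_on_subset[OF e_cont sub]
        by (auto intro: linear_continuous_on_compose matrix_vector_mul_linear)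
      show "t \<in> {c..T}" using t Ic by blast
      fix r assume r: "r \<in> {c<..<T} - S"
      then show "(e has_vector_derivative error_matrix Qbar M *v e r) (at r)"
        using e_deriv[of r] cI[of r] err_dot[of r] c0 by auto
    qed
  qed
  then show ?thesis using err_dot by (simp add: e_def)
qed

end
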